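(* For each $s<t$ in $\mathbb R$ and each $\varphi\in L^2(\mathbb R^n,\nu_t)$, $$\|P_{s,t}(\varphi-M_t\varphi)\|_{L^2(\mathbb R^n,\nu_s)}\le e^{c_0(t-s)}\|\varphi\|_{L^2(\mathbb R^n,\nu_t)}.$$
   Context: Let $n\ge 1$ and let $A,B:\mathbb R\to\mathcal L(\mathbb R^n)$, $f:\mathbb R\to\mathbb R^n$ be continuous and bounded (not necessarily periodic), with $\|B(t)x\|\ge \mu_0\|x\|$ for all $t,x$ and some $\mu_0>0$. Let $U(t,s)$ be the evolution operator of $\xi'=A(t)\xi$, and assume $\omega_0(U):=\inf\{\omega:\exists M,\ \|U(t,s)\|\le Me^{\omega(t-s)}\ \forall s\le t\}<0$; for each $\omega\in(\omega_0(U),0)$ let $M(\omega)$ be a constant with $\|U(t,s)\|\le M(\omega)e^{\omega(t-s)}$ for all $s\le t$. Let $C:=\sup_{t}\|B(t)\|$ and $c_0:=\inf\{\omega\mu_0^2/(M(\omega)^2C^2):\ \omega\in(\omega_0(U),0)\}$. For $-\infty\le s<t$ let $Q(t,s)=\int_s^tU(t,r)B(r)B^*(r)U^*(t,r)dr$, $g(t,s)=\int_s^tU(t,r)f(r)dr$, $\nu_t=\mathcal N_{g(t,-\infty),Q(t,-\infty)}$ (Gaussian measure on $\mathbb R^n$). $P_{s,t}\varphi(x)=\int_{\mathbb R^n}\varphi(y)\,\mathcal N_{U(t,s)x+g(t,s),Q(t,s)}(dy)$, extended to a contraction $L^2(\mathbb R^n,\nu_t)\to L^2(\mathbb R^n,\nu_s)$.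 $M_t\varphi:=\int_{\mathbb R^n}\varphi\,d\nu_t$. *)

theory Defs
  imports "HOL-Probability.Probability"
begin

definition opnorm :: "real^'n^'n \<Rightarrow> real" where
  "opnorm M = onorm (\<lambda>x. M *v x)"

definition evolution_operator ::
  "(real \<Rightarrow> real^'n^'n) \<Rightarrow> (real \<Rightarrow> real \<Rightarrow> real^'n^'n) \<Rightarrow> bool" where
  "evolution_operator A U \<longleftrightarrow>
     (\<forall>s. U s s = mat 1 \<and>
          (\<forall>t. ((\<lambda>\<tau>. U \<tau> s) has_vector_derivative (A t ** U t s)) (at t)))"

definition gaussian_measure :: "real^'n \<Rightarrow> real^'n^'n \<Rightarrow> (real^'n) measure" where
  "gaussian_measure m Q = density lborel
     (\<lambda>x. ennreal (exp (- ((x - m) \<bullet> (matrix_inv Q *v (x - m))) / 2)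
                   / sqrt ((2 * pi) ^ CARD('n) * det Q)))"

end

theory Submission
  imports Defs
begin

text \<open>
  Write \<open>Q\<^sub>t\<close> for the covariance of \<open>\<nu>\<^sub>t\<close> and \<open>U = U(t,s)\<close>, so that \<open>Q\<^sub>t = U Q\<^sub>s U\<^sup>T + Q(t,s)\<close>.
  For fixed \<open>x\<close> the function \<open>h(r) = \<langle>Q\<^sub>r U(t,r)\<^sup>T x, U(t,r)\<^sup>T x\<rangle>\<close> has derivative \<open>|B(r)\<^sup>T U(t,r)\<^sup>T x|\<^sup>2\<close>; the lower
  bound on \<open>B\<close> and the exponential decay of \<open>U\<close> turn this into \<open>h' \<ge> -2 c h\<close> with \<open>c = \<omega> \<mu>\<^sub>0\<^sup>2 / (M(\<omega>)\<^sup>2 C\<^sup>2)\<close>,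
  hence \<open>U Q\<^sub>s U\<^sup>T \<le> e\<^bsup>2c(t-s)\<^esup> Q\<^sub>t\<close>.
  If \<open>U Q\<^sub>s U\<^sup>T < \<rho>\<^sup>2 Q\<^sub>t\<close>, then \<open>P\<^sub>s\<^sub>,\<^sub>t\<close> is the Mehler operator \<open>T\<^sub>\<rho>\<close> of \<open>\<nu>\<^sub>t\<close> followed by a Gaussian Markov
  kernel that carries \<open>\<nu>\<^sub>s\<close> to \<open>\<nu>\<^sub>t\<close>, so it remains to see that \<open>T\<^sub>\<rho>\<close> contracts mean-zero functions by \<open>\<rho>\<close>.
  Since \<open>T\<^sub>\<rho>\<close> is symmetric with \<open>T\<^sub>\<rho> T\<^sub>\<rho> = T(\<rho>\<^sup>2)\<close>, its norm \<open>q(\<rho>)\<close> on that space satisfies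
  \<open>q(\<rho>)\<^sup>2 \<le> q(\<rho>\<^sup>2)\<close>, while the Hilbert--Schmidt norm of the kernel gives \<open>q(r) \<le> K r\<close> for small \<open>r\<close>; iterating,
  \<open>q(\<rho>) \<le> K\<^bsup>1/N\<^esup> \<rho>\<close> for \<open>N = 2\<^sup>j\<close>, and \<open>j \<rightarrow> \<infinity>\<close>.
\<close>

section \<open>Linear change of variables for the Lebesgue measure\<close>

text \<open>The constant \<open>c\<close> balances two estimates at v = U(t,r)^T x: B^T inherits the
  lower bound of B, so h'(r) >= \<mu>0^2 |v|^2, and integrating the decay of U up to r gives h(r) <=
  M(\<omega>)^2 C^2 / (-2 \<omega>) |v|^2. A Gaussian measure is defined here by a density with an
  inverse and a determinant, so degenerate covariances are excluded. The auxiliary kernel has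
  covariance Q_t - \<rho>^(-2) U Q_s U^T, which may be singular at the optimal \<rho>; hence
  everything is proved for \<rho> strictly above exp(c (t - s)), and the limit is taken only in the
  final inequality between numbers. The same slack absorbs an infimum \<open>c0\<close> that need
  not be attained. The Mehler gap is found without Hermite expansion. Markov kernels by themselves
  give only the bound 1; the rate becomes visible for small r, where the trace (1 - r)^(-n) is 1 +
  O(r). Repeated squaring carries it back to the given \<rho>.\<close>

lemma nn_integral_lborel_translate:
  fixes f :: "'a::euclidean_space \<Rightarrow> ennreal"
  assumes [measurable]: "f \<in> borel_measurable borel"
  shows "(\<integral>\<^sup>+x. f (x + a) \<partial>lborel) = (\<integral>\<^sup>+x. f x \<partial>lborel)"
  by (subst (2) lborel_distr_plus[of a, symmetric])
     (simp add: nn_integral_distr add.commute)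

lemma nn_integral_std_normal_translate:
  "(\<integral>\<^sup>+a. ennreal (std_normal_density (u + a)) \<partial>lborel) = 1"
proof -
  have "(\<integral>\<^sup>+a. ennreal (std_normal_density (a + u)) \<partial>lborel) = (\<integral>\<^sup>+a. ennreal (std_normal_density a) \<partial>lborel)"
    by (rule nn_integral_lborel_translate) simp
  also have "\<dots> = 1"
    by (subst nn_integral_eq_integral) auto
  finally show ?thesis by (simp add: add.commute)
qed

text \<open>Averaging over translations along \<open>e\<close> against a probability density in the
  direction \<open>e\<close> reduces the change of variables to the one-dimensional affine one.\<close>
lemma nn_integral_rank_one_perturbation:
  fixes e l :: "'a::euclidean_space" and f :: "'a \<Rightarrow> ennreal"
  assumes [measurable]: "f \<in> borel_measurable borel" and e: "e \<noteq> 0" and k: "1 + l \<bullet> e \<noteq> 0"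
  shows "ennreal \<bar>1 + l \<bullet> e\<bar> * (\<integral>\<^sup>+x. f (x + (l \<bullet> x) *\<^sub>R e) \<partial>lborel) = (\<integral>\<^sup>+x. f x \<partial>lborel)"
proof -
  \<comment> \<open>\<open>p\<close> is dual to \<open>e\<close>: translating x by -a e lowers p . x
    by exactly a, so the weight can travel with the translation.\<close>
  define p where "p = e /\<^sub>R (e \<bullet> e)"
  have pe: "p \<bullet> e = 1" using e by (simp add: p_def)
  define h where "h u = ennreal (std_normal_density u)" for u
  have h1: "(\<integral>\<^sup>+a. h (u + a) \<partial>lborel) = 1" for u
    using nn_integral_std_normal_translate[of u] by (simp add: h_def)
  have [measurable]: "h \<in> borel_measurable borel" by (simp add: h_def[abs_def])
  \<comment> \<open>Stated for every \<open>m\<close> because both sides of the claim are averaged: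
    \<open>m = 0\<close> gives the plain integral, \<open>m = l\<close> the perturbed one.\<close>
  have avg: "(\<integral>\<^sup>+x. f (x + (m \<bullet> x) *\<^sub>R e) \<partial>lborel) =
      (\<integral>\<^sup>+x. h (p \<bullet> x) * (\<integral>\<^sup>+a. f (x + (m \<bullet> x) *\<^sub>R e + (- (1 + m \<bullet> e) * a) *\<^sub>R e) \<partial>lborel) \<partial>lborel)" for m
  proof -
    let ?T = "\<lambda>x. x + (m \<bullet> x) *\<^sub>R e"
    have "(\<integral>\<^sup>+x. f (?T x) \<partial>lborel) = (\<integral>\<^sup>+x. f (?T x) * (\<integral>\<^sup>+a. h (p \<bullet> x + a) \<partial>lborel) \<partial>lborel)"
      by (simp add: h1)
    also have "\<dots> = (\<integral>\<^sup>+x. (\<integral>\<^sup>+a. f (?T x) * h (p \<bullet> x + a) \<partial>lborel) \<partial>lborel)"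
      by (intro nn_integral_cong nn_integral_cmult[symmetric]) simp
    also have "\<dots> = (\<integral>\<^sup>+a. (\<integral>\<^sup>+x. f (?T x) * h (p \<bullet> x + a) \<partial>lborel) \<partial>lborel)"
      by (rule lborel_pair.Fubini') simp
    also have "\<dots> = (\<integral>\<^sup>+a. (\<integral>\<^sup>+x. f (?T x + (- (1 + m \<bullet> e) * a) *\<^sub>R e) * h (p \<bullet> x) \<partial>lborel) \<partial>lborel)"
    proof (rule nn_integral_cong)
      \<comment> \<open>Substituting x - a e moves the argument of \<open>f\<close> by -(1 + m . e)
        a along \<open>e\<close> and cancels the shift in the weight.\<close>
      fix a :: real
      have "(\<integral>\<^sup>+x. f (?T x) * h (p \<bullet> x + a) \<partial>lborel)
        = (\<integral>\<^sup>+x. f (?T (x + (-a) *\<^sub>R e)) * h (p \<bullet> (x + (-a) *\<^sub>R e) + a) \<partial>lborel)"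
        by (rule nn_integral_lborel_translate[symmetric]) simp
      also have "\<dots> = (\<integral>\<^sup>+x. f (?T x + (- (1 + m \<bullet> e) * a) *\<^sub>R e) * h (p \<bullet> x) \<partial>lborel)"
        by (simp add: inner_simps pe algebra_simps)
      finally show "(\<integral>\<^sup>+x. f (?T x) * h (p \<bullet> x + a) \<partial>lborel) = \<dots>" .
    qed
    also have "\<dots> = (\<integral>\<^sup>+x. (\<integral>\<^sup>+a. f (?T x + (- (1 + m \<bullet> e) * a) *\<^sub>R e) * h (p \<bullet> x) \<partial>lborel) \<partial>lborel)"
      by (rule lborel_pair.Fubini') simp
    also have "\<dots> = (\<integral>\<^sup>+x. h (p \<bullet> x) * (\<integral>\<^sup>+a. f (?T x + (- (1 + m \<bullet> e) * a) *\<^sub>R e) \<partial>lborel) \<partial>lborel)"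
      by (intro nn_integral_cong, subst nn_integral_multc) (simp_all add: mult.commute)
    finally show ?thesis .
  qed
  have "(\<integral>\<^sup>+x. f x \<partial>lborel) = (\<integral>\<^sup>+x. f (x + (0 \<bullet> x) *\<^sub>R e) \<partial>lborel)" by simp
  also have "\<dots> = (\<integral>\<^sup>+x. h (p \<bullet> x) * (\<integral>\<^sup>+a. f (x + (- a) *\<^sub>R e) \<partial>lborel) \<partial>lborel)"
    by (subst avg) simp
  also have "\<dots> = (\<integral>\<^sup>+x. h (p \<bullet> x) * (ennreal \<bar>1 + l \<bullet> e\<bar> *
      (\<integral>\<^sup>+a. f (x + (l \<bullet> x) *\<^sub>R e + (- (1 + l \<bullet> e) * a) *\<^sub>R e) \<partial>lborel)) \<partial>lborel)"
  proof (intro nn_integral_cong arg_cong2[where f="(*)"] refl)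
    \<comment> \<open>For fixed x both integrals run along the same line in direction
      \<open>e\<close>; the shift -(l . x) and the scale 1 + l . e form one affine substitution in
      a, which produces the Jacobian.\<close>
    fix x
    have "(\<integral>\<^sup>+a. f (x + (- a) *\<^sub>R e) \<partial>lborel)
      = ennreal \<bar>1 + l \<bullet> e\<bar> * (\<integral>\<^sup>+a. f (x + (- (- (l \<bullet> x) + (1 + l \<bullet> e) * a)) *\<^sub>R e) \<partial>lborel)"
      by (rule nn_integral_real_affine) (use k in auto)
    then show "(\<integral>\<^sup>+a. f (x + (- a) *\<^sub>R e) \<partial>lborel) = ennreal \<bar>1 + l \<bullet> e\<bar> *
      (\<integral>\<^sup>+a. f (x + (l \<bullet> x) *\<^sub>R e + (- (1 + l \<bullet> e) * a) *\<^sub>R e) \<partial>lborel)"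
      by (simp add: algebra_simps)
  qed
  also have "\<dots> = ennreal \<bar>1 + l \<bullet> e\<bar> * (\<integral>\<^sup>+x. f (x + (l \<bullet> x) *\<^sub>R e) \<partial>lborel)"
    by (subst avg[of l]) (simp add: nn_integral_cmult[symmetric] mult.left_commute)
  finally show ?thesis ..
qed

lemma borel_measurable_matrix_vector_mult [measurable]:
  fixes S :: "real^'n^'m"
  shows "(*v) S \<in> borel_measurable borel"
  by (intro borel_measurable_continuous_onI continuous_intros)

lemma axis_nth_eq: "axis i x $ j = (if j = i then x else 0)"
  by (simp add: axis_def)

text \<open>The claim passes to products, so elementary matrices suffice. A zero row contradicts the
  hypothesis on the determinant, a diagonal matrix scales the axes, and swaps and shears have the
  form x + (l . x) e of the rank-one lemma.\<close>

lemma nn_integral_linear_change_of_variables: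
  fixes S :: "real^'n^'n" and f :: "real^'n \<Rightarrow> ennreal"
  assumes "f \<in> borel_measurable borel" "det S \<noteq> 0"
  shows "ennreal \<bar>det S\<bar> * (\<integral>\<^sup>+x. f (S *v x) \<partial>lborel) = (\<integral>\<^sup>+x. f x \<partial>lborel)"
proof -
  define P where "P S \<longleftrightarrow> (det S \<noteq> 0 \<longrightarrow> (\<forall>f::real^'n \<Rightarrow> ennreal. f \<in> borel_measurable borel \<longrightarrow>
    ennreal \<bar>det S\<bar> * (\<integral>\<^sup>+x. f (S *v x) \<partial>lborel) = (\<integral>\<^sup>+x. f x \<partial>lborel)))" for S :: "real^'n^'n"
  have "P S"
  proof (rule induct_matrix_elementary)
    fix A B :: "real^'n^'n"
    assume A: "P A" and B: "P B"
    show "P (A ** B)"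
      unfolding P_def
    proof (intro impI allI)
      fix f :: "real^'n \<Rightarrow> ennreal"
      assume d: "det (A ** B) \<noteq> 0" and [measurable]: "f \<in> borel_measurable borel"
      have dd: "det A \<noteq> 0" "det B \<noteq> 0" using d by (auto simp: det_mul)
      have "ennreal \<bar>det (A ** B)\<bar> * (\<integral>\<^sup>+x. f ((A ** B) *v x) \<partial>lborel)
        = ennreal \<bar>det A\<bar> * (ennreal \<bar>det B\<bar> * (\<integral>\<^sup>+x. f (A *v (B *v x)) \<partial>lborel))"
        by (simp add: det_mul abs_mult ennreal_mult mult.assoc matrix_vector_mul_assoc)
      also have "ennreal \<bar>det B\<bar> * (\<integral>\<^sup>+x. f (A *v (B *v x)) \<partial>lborel) = (\<integral>\<^sup>+x. f (A *v x) \<partial>lborel)"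
        using B dd unfolding P_def by (auto dest: spec[where x="\<lambda>x. f (A *v x)"])
      also have "ennreal \<bar>det A\<bar> * \<dots> = (\<integral>\<^sup>+x. f x \<partial>lborel)"
        using A dd unfolding P_def by simp
      finally show "ennreal \<bar>det (A ** B)\<bar> * (\<integral>\<^sup>+x. f ((A ** B) *v x) \<partial>lborel) = (\<integral>\<^sup>+x. f x \<partial>lborel)" .
    qed
  next
    fix A :: "real^'n^'n" and i assume "row i A = 0"
    then show "P A" by (simp add: P_def det_zero_row)
  next
    fix A :: "real^'n^'n" assume A: "\<And>i j. i \<noteq> j \<Longrightarrow> A $ i $ j = 0"
    show "P A"
      unfolding P_def
    proof (intro impI allI)
      fix f :: "real^'n \<Rightarrow> ennreal"
      assume d: "det A \<noteq> 0" and [measurable]: "f \<in> borel_measurable borel"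
      have dA: "det A = (\<Prod>i\<in>UNIV. A $ i $ i)" by (rule det_diagonal) (rule A)
      define c :: "real^'n \<Rightarrow> real" where "c b = b \<bullet> (A *v b)" for b
      have cA: "c (axis i 1) = A $ i $ i" for i
        by (simp add: c_def matrix_vector_mult_basis column_def inner_axis' )
      have B: "(Basis :: (real^'n) set) = (\<lambda>i. axis i 1) ` UNIV" by (auto simp: Basis_vec_def)
      have inj: "inj (\<lambda>i::'n. axis i (1::real))" by (auto simp: inj_on_def axis_eq_axis)
      have pr: "(\<Prod>j\<in>Basis. \<bar>c j\<bar>) = \<bar>det A\<bar>"
        unfolding B dA by (subst prod.reindex[OF inj]) (simp add: cA abs_prod o_def)
      have nz: "c j \<noteq> 0" if "j \<in> Basis" for j
        using d that unfolding dA B by (auto simp: cA)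
      have T: "0 + (\<Sum>j\<in>Basis. (c j * (x \<bullet> j)) *\<^sub>R j) = A *v x" for x
      proof -
        have "(\<Sum>j\<in>Basis. (c j * (x \<bullet> j)) *\<^sub>R j) = (\<Sum>i\<in>UNIV. (A $ i $ i * x $ i) *\<^sub>R axis i 1)"
          unfolding B by (subst sum.reindex[OF inj]) (simp add: cA inner_axis)
        also have "\<dots> = A *v x"
        proof (subst vec_eq_iff, rule allI)
          fix k
          have "(A *v x) $ k = (\<Sum>j\<in>UNIV. A $ k $ j * x $ j)" by (simp add: matrix_vector_mult_def)
          also have "\<dots> = (\<Sum>j\<in>UNIV. if j = k then A $ k $ k * x $ k else 0)"
            by (rule sum.cong) (auto simp: A)
          finally show "(\<Sum>i\<in>UNIV. (A $ i $ i * x $ i) *\<^sub>R axis i 1) $ k = (A *v x) $ k"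
            by (simp add: axis_def if_distrib cong: if_cong)
        qed
        finally show ?thesis by simp
      qed
      have "(\<integral>\<^sup>+x. f x \<partial>lborel) = (\<integral>\<^sup>+x. f x \<partial>density (distr lborel borel ((*v) A)) (\<lambda>_. ennreal \<bar>det A\<bar>))"
        using lborel_affine_euclidean[of c 0, OF nz] unfolding T pr by simp
      also have "\<dots> = ennreal \<bar>det A\<bar> * (\<integral>\<^sup>+x. f (A *v x) \<partial>lborel)"
        by (simp add: nn_integral_density nn_integral_distr nn_integral_cmult)
      finally show "ennreal \<bar>det A\<bar> * (\<integral>\<^sup>+x. f (A *v x) \<partial>lborel) = (\<integral>\<^sup>+x. f x \<partial>lborel)" ..
    qed
  next
    fix m n :: 'n assume mn: "m \<noteq> n"
    let ?A = "\<chi> i j. mat 1 $ i $ Transposition.transpose m n j :: real^'n^'n"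
    \<comment> \<open>A swap of two coordinates is the reflection in the hyperplane orthogonal to
      \<open>?e\<close>; with \<open>l = - ?e\<close> the factor 1 + l . e equals -1.\<close>
    let ?e = "axis m 1 - axis n 1 :: real^'n"
    have dA: "det ?A = -1"
      using det_permute_columns[of "Transposition.transpose m n" "mat 1 :: real^'n^'n"] mn
      by (simp add: sign_swap_id permutes_swap_id)
    have Ax: "?A *v x = x + ((- ?e) \<bullet> x) *\<^sub>R ?e" for x :: "real^'n"
    proof (subst vec_eq_iff, rule allI)
      fix k
      have "(?A *v x) $ k = (\<Sum>j\<in>UNIV. if j = Transposition.transpose m n k then x $ j else 0)"
      proof -
        have "k = Transposition.transpose m n j \<longleftrightarrow> j = Transposition.transpose m n k" for j
          by (metis transpose_involutory)
        then show ?thesis by (simp add: matrix_vector_mult_def mat_def if_distrib if_distribR cong: if_cong)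
      qed
      also have "\<dots> = x $ Transposition.transpose m n k" by simp
      finally show "(?A *v x) $ k = (x + ((- ?e) \<bullet> x) *\<^sub>R ?e) $ k"
        using mn by (auto simp: Transposition.transpose_def axis_nth_eq inner_diff_left inner_axis')
    qed
    have "?e \<noteq> 0" using mn by (metis axis_eq_axis eq_iff_diff_eq_0 zero_neq_one)
    moreover have "(- ?e) \<bullet> ?e = - 2" using mn by (simp add: inner_simps inner_axis_axis)
    ultimately show "P ?A"
      unfolding P_def dA Ax using nn_integral_rank_one_perturbation[of _ ?e "- ?e"] by simp
  next
    fix m n :: 'n and c :: real assume mn: "m \<noteq> n"
    let ?A = "\<chi> i j. if i = m \<and> j = n then c else of_bool (i = j) :: real^'n^'n"
    have "?A = (\<chi> k. if k = m then row m (mat 1) + c *s row n (mat 1) else row k (mat 1))"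
      using mn by (auto simp: vec_eq_iff row_def mat_def)
    then have dA: "det ?A = 1"
      using det_row_operation[OF mn, of "mat 1" c] by simp
    have Ax: "?A *v x = x + ((c *\<^sub>R axis n 1) \<bullet> x) *\<^sub>R axis m 1" for x :: "real^'n"
    proof (subst vec_eq_iff, rule allI)
      fix k
      have "(?A *v x) $ k = (\<Sum>j\<in>UNIV. (if j = k then x $ j else 0) + (if j = n then (if k = m then c * x $ j else 0) else 0))"
        unfolding matrix_vector_mult_def using mn
        by (auto intro!: sum.cong)
      also have "\<dots> = x $ k + (if k = m then c * x $ n else 0)" by (simp add: sum.distrib)
      finally show "(?A *v x) $ k = (x + ((c *\<^sub>R axis n 1) \<bullet> x) *\<^sub>R axis m 1) $ k"
        by (auto simp: axis_nth_eq inner_axis')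
    qed
    have "axis m (1::real) \<noteq> 0" by (simp add: axis_eq_0_iff)
    moreover have "axis n (1::real) \<bullet> axis m 1 = 0" using mn by (simp add: inner_axis_axis)
    ultimately show "P ?A"
      unfolding P_def dA Ax using nn_integral_rank_one_perturbation[of _ "axis m (1::real)" "c *\<^sub>R axis n 1"] by simp
  qed
  then show ?thesis using assms unfolding P_def by blast
qed

section \<open>Gaussian integrals and Gaussian measures\<close>

definition pos_def :: "real^'n^'n \<Rightarrow> bool" where
  "pos_def Q \<longleftrightarrow> transpose Q = Q \<and> (\<forall>x. x \<noteq> 0 \<longrightarrow> 0 < x \<bullet> (Q *v x))"

lemma pos_def_sym: "pos_def Q \<Longrightarrow> x \<bullet> (Q *v y) = y \<bullet> (Q *v x)"
  unfolding pos_def_def by (metis dot_lmul_matrix inner_commute transpose_matrix_vector)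

lemma pos_def_mult:
  assumes "pos_def Q" "c > 0"
  shows "pos_def (c *\<^sub>R Q)"
  using assms by (auto simp: pos_def_def transpose_scalar scaleR_matrix_vector_assoc[symmetric])

lemma pos_def_add: "pos_def Q \<Longrightarrow> pos_def R \<Longrightarrow> pos_def (Q + R)"
  by (auto simp: pos_def_def transpose_def vec_eq_iff matrix_vector_mult_add_rdistrib inner_add_right add_pos_pos)

lemma dot_congruence: "x \<bullet> ((L ** Q ** transpose L) *v y) = (transpose L *v x) \<bullet> (Q *v (transpose L *v y))"
  for L :: "real^'n^'m"
  by (simp add: matrix_vector_mul_assoc[symmetric] dot_lmul_matrix)

lemma pos_def_congruence:
  fixes L Q :: "real^'n^'n"
  assumes "pos_def Q" "det L \<noteq> 0"
  shows "pos_def (L ** Q ** transpose L)"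
proof -
  have "transpose (L ** Q ** transpose L) = L ** Q ** transpose L"
    using assms(1) by (simp add: pos_def_def matrix_transpose_mul matrix_mul_assoc)
  moreover have "0 < x \<bullet> ((L ** Q ** transpose L) *v x)" if "x \<noteq> 0" for x
  proof -
    have "invertible (transpose L)"
      using assms(2) by (simp add: invertible_det_nz)
    then have "transpose L *v x \<noteq> 0"
      using that inj_matrix_vector_mult[of "transpose L"] by (metis injD matrix_vector_mult_0_right)
    then show ?thesis
      using assms(1) unfolding dot_congruence pos_def_def by blast
  qed
  ultimately show ?thesis by (simp add: pos_def_def)
qed

lemma matrix_add_rdistrib: "(A + B) ** C = A ** C + B ** C" for A B :: "real^'n^'m"
  by (simp add: matrix_matrix_mult_def vec_eq_iff distrib_right sum.distrib)

lemma matrix_inv_mult: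
  fixes A :: "real^'n^'n"
  assumes "invertible A"
  shows "A ** matrix_inv A = mat 1" "matrix_inv A ** A = mat 1"
  using someI_ex[of "\<lambda>A'. A ** A' = mat 1 \<and> A' ** A = mat 1"] assms
  unfolding invertible_def matrix_inv_def by auto

lemma matrix_inv_eqI:
  fixes A B :: "real^'n^'n"
  assumes "A ** B = mat 1"
  shows "matrix_inv A = B"
proof -
  have "B ** A = mat 1" using assms by (simp add: matrix_left_right_inverse)
  then have "invertible A" using assms by (auto simp: invertible_def)
  then have "matrix_inv A = matrix_inv A ** (A ** B)" by (simp add: assms)
  also have "\<dots> = B" by (simp add: matrix_mul_assoc matrix_inv_mult \<open>invertible A\<close>)
  finally show ?thesis .
qed

lemma pos_def_invertible:
  assumes "pos_def Q"
  shows "invertible Q"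
proof -
  have "x = 0" if "Q *v x = 0" for x
    using assms that unfolding pos_def_def by (metis inner_zero_right less_irrefl)
  then show ?thesis
    by (meson invertible_left_inverse matrix_left_invertible_ker)
qed

lemma pos_def_matrix_inv:
  assumes "pos_def Q"
  shows "pos_def (matrix_inv Q)"
proof -
  note i = matrix_inv_mult[OF pos_def_invertible[OF assms]]
  have "transpose (matrix_inv Q) = matrix_inv Q"
    by (rule matrix_inv_eqI[symmetric])
       (metis assms i(2) matrix_transpose_mul pos_def_def transpose_mat)
  moreover have "0 < x \<bullet> (matrix_inv Q *v x)" if "x \<noteq> 0" for x
  proof -
    define y where "y = matrix_inv Q *v x"
    have x: "x = Q *v y" by (simp add: y_def matrix_vector_mul_assoc i)
    with that have "y \<noteq> 0" by auto
    then have "0 < y \<bullet> (Q *v y)" using assms by (simp add: pos_def_def)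
    then show ?thesis by (simp add: x[symmetric] y_def[symmetric] inner_commute)
  qed
  ultimately show ?thesis by (simp add: pos_def_def)
qed

text \<open>Gram--Schmidt for the inner product defined by \<open>W\<close>.\<close>
lemma pos_def_orthonormal_columns:
  fixes W :: "real^'n^'n"
  assumes W: "pos_def W"
  obtains S :: "real^'n^'n" where "transpose S ** W ** S = mat 1"
proof -
  have "\<exists>v::'n \<Rightarrow> real^'n. \<forall>i\<in>J. \<forall>j\<in>J. v i \<bullet> (W *v v j) = of_bool (i = j)" if "finite J" for J
    using that
  proof (induction J)
    case empty
    then show ?case by simp
  next
    case (insert k J)
    then obtain v where v: "\<And>i j. i \<in> J \<Longrightarrow> j \<in> J \<Longrightarrow> v i \<bullet> (W *v v j) = of_bool (i = j)" by blast
    have "dim (v ` J) \<le> card (v ` J)" by (rule dim_le_card') (use insert in simp)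
    also have "\<dots> \<le> card J" by (rule card_image_le) (use insert in simp)
    also have "\<dots> < CARD('n)"
      using insert(2) by (intro psubset_card_mono) auto
    finally have "dim (v ` J) < DIM(real^'n)" by simp
    then have "span (v ` J) \<noteq> UNIV"
      by (metis dim_span dim_UNIV less_irrefl)
    then obtain w where w: "w \<notin> span (v ` J)" by blast
    define u where "u = w - (\<Sum>j\<in>J. (v j \<bullet> (W *v w)) *\<^sub>R v j)"
    have u0: "u \<noteq> 0"
    proof
      assume "u = 0"
      then have "w = (\<Sum>j\<in>J. (v j \<bullet> (W *v w)) *\<^sub>R v j)" by (simp add: u_def)
      also have "\<dots> \<in> span (v ` J)" by (intro span_sum span_scale span_base) auto
      finally show False using w by simp
    qed
    have orth: "v i \<bullet> (W *v u) = 0" if "i \<in> J" for i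
    proof -
      have "W *v u = W *v w - (\<Sum>j\<in>J. (v j \<bullet> (W *v w)) *\<^sub>R (W *v v j))"
        by (simp add: u_def matrix_vector_mult_diff_distrib linear_sum[OF matrix_vector_mul_linear] matrix_vector_mult_scaleR)
      then have "v i \<bullet> (W *v u) = v i \<bullet> (W *v w) - (\<Sum>j\<in>J. (v j \<bullet> (W *v w)) * (v i \<bullet> (W *v v j)))"
        by (simp add: inner_diff_right inner_sum_right)
      also have "(\<Sum>j\<in>J. (v j \<bullet> (W *v w)) * (v i \<bullet> (W *v v j))) = (\<Sum>j\<in>J. if j = i then v i \<bullet> (W *v w) else 0)"
        by (intro sum.cong) (auto simp: v that)
      finally show ?thesis using that insert by simp
    qed
    define q where "q = u \<bullet> (W *v u)"
    have q: "q > 0" using W u0 by (simp add: q_def pos_def_def)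
    define v' where "v' = v(k := u /\<^sub>R sqrt q)"
    have "v' i \<bullet> (W *v v' j) = of_bool (i = j)" if mem: "i \<in> insert k J" "j \<in> insert k J" for i j
    proof -
      have kk: "v' k \<bullet> (W *v v' k) = 1"
        using q by (simp add: v'_def matrix_vector_mult_scaleR q_def[symmetric] power2_eq_square[symmetric] flip: power_inverse)
          (simp add: field_simps)
      have jk: "v' i \<bullet> (W *v v' k) = 0" if "i \<in> J" for i
        using that insert orth by (auto simp: v'_def matrix_vector_mult_scaleR)
      have kj: "v' k \<bullet> (W *v v' i) = 0" if "i \<in> J" for i
        using jk[OF that] pos_def_sym[OF W] by metis
      have ij: "v' i \<bullet> (W *v v' j) = of_bool (i = j)" if "i \<in> J" "j \<in> J" for i j
        using v[OF that] that insert(2) by (auto simp: v'_def)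
      consider "i = k" "j = k" | "i = k" "j \<in> J" | "i \<in> J" "j = k" | "i \<in> J" "j \<in> J"
        using mem by blast
      then show ?thesis
      proof cases
        case 1 then show ?thesis using kk by simp
      next
        case 2 then show ?thesis using kj[of j] insert(2) by auto
      next
        case 3 then show ?thesis using jk[of i] insert(2) by auto
      next
        case 4 then show ?thesis by (rule ij)
      qed
    qed
    then show ?case by blast
  qed
  from this[of UNIV] obtain v :: "'n \<Rightarrow> real^'n" where
    v: "\<And>i j. v i \<bullet> (W *v v j) = of_bool (i = j)" by auto
  define S where "S = (\<chi> i j. v j $ i)"
  have col: "column j S = v j" for j by (simp add: S_def column_def vec_eq_iff)
  have "(transpose S ** W ** S) $ i $ j = mat 1 $ i $ j" for i j
  proof -
    have "(transpose S ** W ** S) $ i $ j = axis i 1 \<bullet> ((transpose S ** W ** S) *v axis j 1)"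
      by (simp add: matrix_vector_mult_basis column_def inner_axis')
    also have "\<dots> = (S *v axis i 1) \<bullet> (W *v (S *v axis j 1))"
      using dot_congruence[of _ "transpose S" W] by simp
    also have "\<dots> = mat 1 $ i $ j"
      by (simp add: matrix_vector_mult_basis col v mat_def)
    finally show ?thesis .
  qed
  then have "transpose S ** W ** S = mat 1" by (simp add: vec_eq_iff)
  then show ?thesis by (rule that)
qed

text \<open>Determinants in S^T W S = I give (det S)^2 det W = 1, which avoids eigenvalues.\<close>

lemma pos_def_det_pos:
  fixes W :: "real^'n^'n"
  assumes "pos_def W"
  shows "det W > 0"
proof -
  obtain S :: "real^'n^'n" where "transpose S ** W ** S = mat 1" by (rule pos_def_orthonormal_columns[OF assms])
  then have "det S * det W * det S = 1" by (metis det_I det_mul det_transpose)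
  then have "(det S)\<^sup>2 * det W = 1" by (simp add: power2_eq_square algebra_simps)
  then show ?thesis by (smt (verit) mult_nonneg_nonpos zero_le_power2)
qed

section \<open>Gaussian integrals, densities and measures\<close>

lemma nn_integral_std_gaussian:
  "(\<integral>\<^sup>+x. ennreal (exp (- ((x::real^'n) \<bullet> x) / 2)) \<partial>lborel) = ennreal (sqrt ((2 * pi) ^ CARD('n)))"
proof -
  have one: "(\<integral>\<^sup>+t. ennreal (exp (- t\<^sup>2 / 2)) \<partial>lborel) = ennreal (sqrt (2 * pi))"
  proof -
    have "(\<integral>\<^sup>+t. ennreal (exp (- t\<^sup>2 / 2)) \<partial>lborel) = (\<integral>\<^sup>+t. ennreal (sqrt (2 * pi)) * ennreal (std_normal_density (0 + t)) \<partial>lborel)"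
      by (intro nn_integral_cong) (simp add: std_normal_density_def flip: ennreal_mult)
    also have "\<dots> = ennreal (sqrt (2 * pi))"
      by (subst nn_integral_cmult) (auto simp: nn_integral_std_normal_translate[of 0, simplified])
    finally show ?thesis .
  qed
  have "(\<integral>\<^sup>+x. ennreal (exp (- ((x::real^'n) \<bullet> x) / 2)) \<partial>lborel)
      = (\<integral>\<^sup>+x. (\<Prod>b\<in>Basis. ennreal (exp (- ((x::real^'n) \<bullet> b)\<^sup>2 / 2))) \<partial>lborel)"
  proof (intro nn_integral_cong)
    fix x :: "real^'n"
    have "- (x \<bullet> x) / 2 = (\<Sum>b\<in>Basis. - (x \<bullet> b)\<^sup>2 / 2)"
      by (subst euclidean_inner) (simp add: sum_negf sum_divide_distrib power2_eq_square)
    then show "ennreal (exp (- (x \<bullet> x) / 2)) = (\<Prod>b\<in>Basis. ennreal (exp (- (x \<bullet> b)\<^sup>2 / 2)))"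
      by (simp add: exp_sum prod_ennreal)
  qed
  also have "\<dots> = (\<Prod>b\<in>(Basis :: (real^'n) set). (\<integral>\<^sup>+t. ennreal (exp (- t\<^sup>2 / 2)) \<partial>lborel))"
    by (rule nn_integral_lborel_prod) auto
  also have "\<dots> = ennreal (sqrt ((2 * pi) ^ CARD('n)))"
    unfolding one by (simp add: ennreal_power flip: real_sqrt_power)
  finally show ?thesis .
qed

text \<open>The columns of S are orthonormal for W, so the substitution x = c + S y turns the
  exponent into -|y|^2 / 2, with Jacobian |det S| = (det W)^(-1/2).\<close>

lemma nn_integral_gaussian:
  fixes W :: "real^'n^'n"
  assumes W: "pos_def W"
  shows "(\<integral>\<^sup>+x. ennreal (exp (- ((x - c) \<bullet> (W *v (x - c))) / 2)) \<partial>lborel)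
    = ennreal (sqrt ((2 * pi) ^ CARD('n) / det W))"
proof -
  obtain S :: "real^'n^'n" where S: "transpose S ** W ** S = mat 1" by (rule pos_def_orthonormal_columns[OF W])
  then have "det S * det W * det S = 1" by (metis det_I det_mul det_transpose)
  then have dS: "(det S)\<^sup>2 = 1 / det W"
    using pos_def_det_pos[OF W] by (simp add: power2_eq_square field_simps)
  then have dS': "\<bar>det S\<bar> = sqrt (1 / det W)" by (metis real_sqrt_abs)
  have "(\<integral>\<^sup>+x. ennreal (exp (- ((x - c) \<bullet> (W *v (x - c))) / 2)) \<partial>lborel)
    = (\<integral>\<^sup>+x. ennreal (exp (- (((x + c) - c) \<bullet> (W *v ((x + c) - c))) / 2)) \<partial>lborel)"
    by (rule nn_integral_lborel_translate[symmetric]) simp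
  also have "\<dots> = (\<integral>\<^sup>+x. ennreal (exp (- (x \<bullet> (W *v x)) / 2)) \<partial>lborel)" by simp
  also have "\<dots> = ennreal \<bar>det S\<bar> * (\<integral>\<^sup>+x. ennreal (exp (- ((S *v x) \<bullet> (W *v (S *v x))) / 2)) \<partial>lborel)"
    by (rule nn_integral_linear_change_of_variables[symmetric])
       (use dS pos_def_det_pos[OF W] in auto)
  also have "(\<lambda>x. (S *v x) \<bullet> (W *v (S *v x))) = (\<lambda>x. x \<bullet> x)"
    using dot_congruence[of _ "transpose S" W] S by simp
  finally show ?thesis
    unfolding nn_integral_std_gaussian dS' using pos_def_det_pos[OF W]
    by (simp add: real_sqrt_divide flip: ennreal_mult)
qed

definition gaussian_density :: "real^'n \<Rightarrow> real^'n^'n \<Rightarrow> real^'n \<Rightarrow> real" where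
  "gaussian_density m Q x =
     exp (- ((x - m) \<bullet> (matrix_inv Q *v (x - m))) / 2) / sqrt ((2 * pi) ^ CARD('n) * det Q)"

lemma gaussian_measure_density: "gaussian_measure m Q = density lborel (\<lambda>x. ennreal (gaussian_density m Q x))"
  by (simp add: gaussian_measure_def gaussian_density_def)

lemma gaussian_density_pos: "pos_def Q \<Longrightarrow> 0 < gaussian_density m Q x"
  using pos_def_det_pos[of Q] by (simp add: gaussian_density_def)

lemma borel_measurable_gaussian_density [measurable]:
  assumes [measurable]: "h \<in> borel_measurable M" "h' \<in> borel_measurable M"
  shows "(\<lambda>x. gaussian_density (h x) Q (h' x)) \<in> borel_measurable M"
  unfolding gaussian_density_def by measurable

lemma sets_gaussian_measure [simp, measurable_cong]: "sets (gaussian_measure m Q) = sets borel"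
  by (simp add: gaussian_measure_def)

lemma space_gaussian_measure [simp]: "space (gaussian_measure m Q) = UNIV"
  by (simp add: gaussian_measure_def)

lemma det_matrix_inv:
  fixes A :: "real^'n^'n"
  assumes "invertible A" shows "det (matrix_inv A) = 1 / det A"
proof -
  have "det A * det (matrix_inv A) = 1" using matrix_inv_mult(1)[OF assms] by (metis det_I det_mul)
  then show ?thesis by (metis mult_zero_left nonzero_eq_divide_eq mult.commute zero_neq_one)
qed

text \<open>Completing the square in \<open>x\<close> around the regression point \<open>c = Q0 L\<^sup>T (L Q0 L\<^sup>T + Q1)\<^sup>-\<^sup>1 v\<close>.\<close>
lemma nn_integral_gaussian_density_compose:
  fixes L Q0 Q1 :: "real^'n^'n"
  assumes Q0: "pos_def Q0" and Q1: "pos_def Q1" and L: "det L \<noteq> 0"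
  shows "(\<integral>\<^sup>+x. ennreal (gaussian_density m Q0 x) * ennreal (gaussian_density (L *v x + a) Q1 y) \<partial>lborel)
    = ennreal (gaussian_density (L *v m + a) (L ** Q0 ** transpose L + Q1) y)"
proof -
  define S where "S = L ** Q0 ** transpose L + Q1"
  define W0 W1 Si where "W0 = matrix_inv Q0" and "W1 = matrix_inv Q1" and "Si = matrix_inv S"
  have S: "pos_def S" unfolding S_def by (intro pos_def_add pos_def_congruence assms)
  note i0 = matrix_inv_mult[OF pos_def_invertible[OF Q0], folded W0_def]
  note i1 = matrix_inv_mult[OF pos_def_invertible[OF Q1], folded W1_def]
  note iS = matrix_inv_mult[OF pos_def_invertible[OF S], folded Si_def]
  have W0: "pos_def W0" and W1: "pos_def W1" and Si: "pos_def Si"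
    unfolding W0_def W1_def Si_def using pos_def_matrix_inv Q0 Q1 S by auto
  \<comment> \<open>\<open>\<Lambda>\<close> is the quadratic part in x of the joint exponent, that
    is, the inverse covariance of x given y.\<close>
  define \<Lambda> where "\<Lambda> = transpose L ** W1 ** L + W0"
  have \<Lambda>: "pos_def \<Lambda>"
    unfolding \<Lambda>_def using pos_def_congruence[OF W1, of "transpose L"] L W0 by (auto intro: pos_def_add)
  \<comment> \<open>One identity with two uses: its determinant, after cancelling det L, gives the
    normalising constant, and applied to \<open>Si *v v\<close> it identifies \<open>c\<close> as
    the minimiser of the joint exponent.\<close>
  have kal: "\<Lambda> ** (Q0 ** transpose L) = transpose L ** W1 ** S"
  proof -
    have "\<Lambda> ** (Q0 ** transpose L) = transpose L ** W1 ** L ** Q0 ** transpose L + W0 ** Q0 ** transpose L"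
      by (simp add: \<Lambda>_def matrix_add_rdistrib matrix_mul_assoc)
    also have "W0 ** Q0 ** transpose L = transpose L ** (W1 ** Q1)"
      by (simp add: i0 i1)
    finally show ?thesis by (simp add: S_def matrix_add_ldistrib matrix_mul_assoc)
  qed
  have "det \<Lambda> * det Q0 * det L = det L * det W1 * det S"
    using arg_cong[OF kal, of det] by (simp add: det_mul)
  then have detL: "det \<Lambda> * det Q0 * det Q1 = det S"
    using L pos_def_det_pos[OF Q1] det_matrix_inv[OF pos_def_invertible[OF Q1]] by (simp add: W1_def field_simps)
  define v where "v = y - (L *v m + a)"
  define c where "c = (Q0 ** transpose L) *v (Si *v v)"
  have \<Lambda>c: "\<Lambda> *v c = transpose L *v (W1 *v v)"
  proof -
    have "\<Lambda> *v c = (\<Lambda> ** (Q0 ** transpose L)) *v (Si *v v)"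
      by (simp add: c_def matrix_vector_mul_assoc matrix_mul_assoc del: transpose_matrix_vector)
    also have "\<dots> = (transpose L ** W1 ** (S ** Si)) *v v"
      unfolding kal by (simp add: matrix_vector_mul_assoc matrix_mul_assoc del: transpose_matrix_vector)
    finally show ?thesis by (simp add: iS matrix_vector_mul_assoc del: transpose_matrix_vector)
  qed
  have Lc: "L *v c = v - Q1 *v (Si *v v)"
  proof -
    have "L *v c + Q1 *v (Si *v v) = (S ** Si) *v v"
      by (simp add: c_def S_def matrix_vector_mul_assoc matrix_mul_assoc matrix_add_rdistrib matrix_vector_mult_add_rdistrib
        del: transpose_matrix_vector)
    then show ?thesis by (simp add: iS algebra_simps)
  qed
  have sq: "u \<bullet> (W0 *v u) + (v - L *v u) \<bullet> (W1 *v (v - L *v u)) = v \<bullet> (Si *v v) + (u - c) \<bullet> (\<Lambda> *v (u - c))" for u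
  proof -
    have 1: "u \<bullet> (\<Lambda> *v u) = u \<bullet> (W0 *v u) + (L *v u) \<bullet> (W1 *v (L *v u))"
      using dot_congruence[of u "transpose L" W1 u] by (simp add: \<Lambda>_def matrix_vector_mult_add_rdistrib inner_add_right)
    have 2: "u \<bullet> (\<Lambda> *v c) = (L *v u) \<bullet> (W1 *v v)" for u
      unfolding \<Lambda>c by (metis dot_lmul_matrix transpose_matrix_vector transpose_transpose)
    have 3: "c \<bullet> (\<Lambda> *v u) = (L *v u) \<bullet> (W1 *v v)" using 2 pos_def_sym[OF \<Lambda>] by metis
    have "(Q1 *v (Si *v v)) \<bullet> (W1 *v v) = v \<bullet> (W1 *v (Q1 *v (Si *v v)))" by (rule pos_def_sym[OF W1])
    also have "\<dots> = v \<bullet> (Si *v v)" by (simp add: matrix_vector_mul_assoc matrix_mul_assoc i1)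
    finally have 4: "c \<bullet> (\<Lambda> *v c) = v \<bullet> (W1 *v v) - v \<bullet> (Si *v v)"
      unfolding 2 Lc by (simp add: inner_diff_left)
    have 5: "v \<bullet> (W1 *v (L *v u)) = (L *v u) \<bullet> (W1 *v v)" by (rule pos_def_sym[OF W1])
    show ?thesis
      by (simp add: matrix_vector_mult_diff_distrib inner_diff_left inner_diff_right 1 2 3 5) (use 4 2[of c] in simp)
  qed
  define K where "K = (2 * pi) ^ CARD('n)"
  have K: "K > 0" by (simp add: K_def)
  note dets = pos_def_det_pos[OF Q0] pos_def_det_pos[OF Q1] pos_def_det_pos[OF S] pos_def_det_pos[OF \<Lambda>]
  have pt: "ennreal (gaussian_density m Q0 x) * ennreal (gaussian_density (L *v x + a) Q1 y) =
     ennreal (exp (- (v \<bullet> (Si *v v)) / 2) / (sqrt (K * det Q0) * sqrt (K * det Q1))) *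
       ennreal (exp (- ((x - (m + c)) \<bullet> (\<Lambda> *v (x - (m + c)))) / 2))" for x
  proof -
    have e1: "y - (L *v x + a) = v - L *v (x - m)" by (simp add: v_def algebra_simps)
    have e2: "x - (m + c) = (x - m) - c" by simp
    have frac: "a / p * (b / q) = d / (p * q) * e" if "a * b = d * e" for a b d e p q :: real
      using that by simp
    have "exp (- ((x - m) \<bullet> (W0 *v (x - m))) / 2) * exp (- ((v - L *v (x - m)) \<bullet> (W1 *v (v - L *v (x - m)))) / 2)
      = exp (- (v \<bullet> (Si *v v)) / 2) * exp (- (((x - m) - c) \<bullet> (\<Lambda> *v ((x - m) - c))) / 2)"
      using sq[of "x - m"] by (simp add: field_simps flip: exp_add)
    then have "gaussian_density m Q0 x * gaussian_density (L *v x + a) Q1 y =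
      exp (- (v \<bullet> (Si *v v)) / 2) / (sqrt (K * det Q0) * sqrt (K * det Q1)) *
      exp (- ((x - (m + c)) \<bullet> (\<Lambda> *v (x - (m + c)))) / 2)"
      unfolding gaussian_density_def e1 e2 W0_def[symmetric] W1_def[symmetric] K_def[symmetric]
      by (rule frac)
    then show ?thesis
      using gaussian_density_pos[OF Q0, of m x] gaussian_density_pos[OF Q1, of "L *v x + a" y] dets K
      by (subst (1 2) ennreal_mult[symmetric]) auto
  qed
  have "(\<integral>\<^sup>+x. ennreal (gaussian_density m Q0 x) * ennreal (gaussian_density (L *v x + a) Q1 y) \<partial>lborel)
    = ennreal (exp (- (v \<bullet> (Si *v v)) / 2) / (sqrt (K * det Q0) * sqrt (K * det Q1))) * ennreal (sqrt (K / det \<Lambda>))"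
    unfolding pt by (subst nn_integral_cmult, simp, subst nn_integral_gaussian[OF \<Lambda>]) (simp add: K_def)
  also have "\<dots> = ennreal (exp (- (v \<bullet> (Si *v v)) / 2) / sqrt (K * det S))"
  proof -
    have "sqrt (K / det \<Lambda>) / (sqrt (K * det Q0) * sqrt (K * det Q1)) = sqrt (K / det \<Lambda> / (K * det Q0 * (K * det Q1)))"
      by (simp add: real_sqrt_divide real_sqrt_mult)
    also have "K / det \<Lambda> / (K * det Q0 * (K * det Q1)) = 1 / (K * det S)"
      unfolding detL[symmetric] using K by (simp add: field_simps)
    finally have "sqrt (K / det \<Lambda>) / (sqrt (K * det Q0) * sqrt (K * det Q1)) = 1 / sqrt (K * det S)"
      by (simp add: real_sqrt_divide)
    then have "exp (- (v \<bullet> (Si *v v)) / 2) * (sqrt (K / det \<Lambda>) / (sqrt (K * det Q0) * sqrt (K * det Q1)))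
      = exp (- (v \<bullet> (Si *v v)) / 2) / sqrt (K * det S)" by simp
    then show ?thesis using K dets by (simp flip: ennreal_mult)
  qed
  finally show ?thesis
    by (simp add: gaussian_density_def v_def S_def Si_def K_def)
qed

lemma nn_integral_gaussian_density:
  fixes Q :: "real^'n^'n"
  assumes Q: "pos_def Q"
  shows "(\<integral>\<^sup>+x. ennreal (gaussian_density m Q x) \<partial>lborel) = 1"
proof -
  note d = pos_def_det_pos[OF Q]
  have "(\<integral>\<^sup>+x. ennreal (gaussian_density m Q x) \<partial>lborel)
    = (\<integral>\<^sup>+x. ennreal (1 / sqrt ((2 * pi) ^ CARD('n) * det Q)) * ennreal (exp (- ((x - m) \<bullet> (matrix_inv Q *v (x - m))) / 2)) \<partial>lborel)"
    using d by (intro nn_integral_cong) (simp add: gaussian_density_def flip: ennreal_mult)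
  also have "\<dots> = ennreal (1 / sqrt ((2 * pi) ^ CARD('n) * det Q)) * ennreal (sqrt ((2 * pi) ^ CARD('n) * det Q))"
    by (subst nn_integral_cmult, simp, subst nn_integral_gaussian[OF pos_def_matrix_inv[OF Q]])
       (simp add: det_matrix_inv[OF pos_def_invertible[OF Q]])
  also have "\<dots> = 1" using d by (simp flip: ennreal_mult)
  finally show ?thesis .
qed

lemma prob_space_gaussian_measure:
  assumes "pos_def Q" shows "prob_space (gaussian_measure m Q)"
  by standard (simp add: gaussian_measure_density emeasure_density nn_integral_gaussian_density[OF assms])

lemma nn_integral_gaussian_measure:
  assumes "f \<in> borel_measurable borel"
  shows "(\<integral>\<^sup>+x. f x \<partial>gaussian_measure m Q) = (\<integral>\<^sup>+x. ennreal (gaussian_density m Q x) * f x \<partial>lborel)"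
  unfolding gaussian_measure_density using assms by (subst nn_integral_density) auto

text \<open>The Chapman-Kolmogorov relation for affine Gaussian kernels: Tonelli exchanges the
  integrals, and the inner one is the composed density. Being stated in \<open>ennreal\<close>, it
  can itself serve to verify integrability.\<close>

lemma nn_integral_gaussian_measure_compose:
  fixes L Q0 Q1 :: "real^'n^'n"
  assumes "pos_def Q0" "pos_def Q1" "det L \<noteq> 0" and [measurable]: "h \<in> borel_measurable borel"
  shows "(\<integral>\<^sup>+x. (\<integral>\<^sup>+y. h y \<partial>gaussian_measure (L *v x + a) Q1) \<partial>gaussian_measure m Q0)
    = (\<integral>\<^sup>+y. h y \<partial>gaussian_measure (L *v m + a) (L ** Q0 ** transpose L + Q1))"
proof -
  have "(\<integral>\<^sup>+x. (\<integral>\<^sup>+y. h y \<partial>gaussian_measure (L *v x + a) Q1) \<partial>gaussian_measure m Q0)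
    = (\<integral>\<^sup>+x. (\<integral>\<^sup>+y. ennreal (gaussian_density m Q0 x) * ennreal (gaussian_density (L *v x + a) Q1 y) * h y \<partial>lborel) \<partial>lborel)"
    by (simp add: nn_integral_gaussian_measure nn_integral_cmult[symmetric] mult.assoc)
  also have "\<dots> = (\<integral>\<^sup>+y. (\<integral>\<^sup>+x. ennreal (gaussian_density m Q0 x) * ennreal (gaussian_density (L *v x + a) Q1 y) * h y \<partial>lborel) \<partial>lborel)"
    by (rule lborel_pair.Fubini') simp
  also have "\<dots> = (\<integral>\<^sup>+y. ennreal (gaussian_density (L *v m + a) (L ** Q0 ** transpose L + Q1) y) * h y \<partial>lborel)"
    by (simp add: nn_integral_multc nn_integral_gaussian_density_compose assms)
  finally show ?thesis by (simp add: nn_integral_gaussian_measure)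
qed

section \<open>Spectral gap for symmetric Markov kernels\<close>

lemma integrable_mult_square:
  fixes f g :: "'a \<Rightarrow> real"
  assumes [measurable]: "f \<in> borel_measurable M" "g \<in> borel_measurable M"
    and f2: "integrable M (\<lambda>x. (f x)\<^sup>2)" and g2: "integrable M (\<lambda>x. (g x)\<^sup>2)"
  shows "integrable M (\<lambda>x. f x * g x)"
proof (rule Bochner_Integration.integrable_bound[OF Bochner_Integration.integrable_add[OF f2 g2]])
  have "\<bar>a * b\<bar> \<le> a\<^sup>2 + b\<^sup>2" for a b :: real
  proof -
    have "0 \<le> (\<bar>a\<bar> - \<bar>b\<bar>)\<^sup>2" by simp
    then show ?thesis using zero_le_power2[of a] zero_le_power2[of b]
      by (simp only: power2_diff abs_mult power2_abs)
  qed
  then show "AE x in M. norm (f x * g x) \<le> norm ((f x)\<^sup>2 + (g x)\<^sup>2)" by simp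
qed measurable

lemma Cauchy_Schwarz_integral:
  fixes f g :: "'a \<Rightarrow> real"
  assumes [measurable]: "f \<in> borel_measurable M" "g \<in> borel_measurable M"
    and f2: "integrable M (\<lambda>x. (f x)\<^sup>2)" and g2: "integrable M (\<lambda>x. (g x)\<^sup>2)"
  shows "(\<integral>x. f x * g x \<partial>M)\<^sup>2 \<le> (\<integral>x. (f x)\<^sup>2 \<partial>M) * (\<integral>x. (g x)\<^sup>2 \<partial>M)"
proof -
  have fg: "integrable M (\<lambda>x. f x * g x)" using assms by (rule integrable_mult_square)
  have "ennreal ((\<integral>x. \<bar>f x * g x\<bar> \<partial>M)\<^sup>2) = (\<integral>\<^sup>+x. ennreal \<bar>f x\<bar> * ennreal \<bar>g x\<bar> \<partial>M)\<^sup>2"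
    using nn_integral_eq_integral[OF integrable_abs[OF fg]]
    by (simp add: abs_mult ennreal_mult flip: ennreal_power)
  also have "\<dots> \<le> (\<integral>\<^sup>+x. (ennreal \<bar>f x\<bar>)\<^sup>2 \<partial>M) * (\<integral>\<^sup>+x. (ennreal \<bar>g x\<bar>)\<^sup>2 \<partial>M)"
    by (rule Cauchy_Schwarz_nn_integral) auto
  also have "\<dots> = ennreal ((\<integral>x. (f x)\<^sup>2 \<partial>M) * (\<integral>x. (g x)\<^sup>2 \<partial>M))"
    using nn_integral_eq_integral[OF f2] nn_integral_eq_integral[OF g2]
    by (simp add: ennreal_power ennreal_mult)
  finally have "(\<integral>x. \<bar>f x * g x\<bar> \<partial>M)\<^sup>2 \<le> (\<integral>x. (f x)\<^sup>2 \<partial>M) * (\<integral>x. (g x)\<^sup>2 \<partial>M)"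
    by (subst (asm) ennreal_le_iff) auto
  moreover have "(\<integral>x. f x * g x \<partial>M)\<^sup>2 \<le> (\<integral>x. \<bar>f x * g x\<bar> \<partial>M)\<^sup>2"
    using integral_abs_bound[of M "\<lambda>x. f x * g x"] by (metis abs_ge_zero power2_abs power_mono)
  ultimately show ?thesis by linarith
qed

text \<open>Packages Fubini so that the only check is finiteness of one iterated nonnegative
  integral, where Tonelli estimates are available.\<close>

lemma (in pair_sigma_finite) Fubini_integral_nn:
  fixes f :: "'a \<Rightarrow> 'b \<Rightarrow> real"
  assumes [measurable]: "case_prod f \<in> borel_measurable (M1 \<Otimes>\<^sub>M M2)"
    and fin: "(\<integral>\<^sup>+x. (\<integral>\<^sup>+y. ennreal \<bar>f x y\<bar> \<partial>M2) \<partial>M1) < \<infinity>"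
  shows "(\<integral>x. (\<integral>y. f x y \<partial>M2) \<partial>M1) = (\<integral>y. (\<integral>x. f x y \<partial>M1) \<partial>M2)"
proof -
  have "integrable (M1 \<Otimes>\<^sub>M M2) (case_prod f)"
    unfolding integrable_iff_bounded
    using fin by (subst M2.nn_integral_fst[symmetric]) (auto simp: split_beta')
  from Fubini_integral[OF this] show ?thesis by simp
qed

text \<open>If b > r, then (b / r)^(2^j) is unbounded and eventually exceeds K. This replaces taking
  2^j-th roots and letting K^(1/2^j) tend to 1.\<close>

lemma le_of_power_le_bounded:
  fixes b r K :: real
  assumes r: "0 < r" and ev: "\<forall>\<^sub>F j in sequentially. b ^ (2 ^ j) \<le> K * r ^ (2 ^ j)"
  shows "b \<le> r"
proof (rule ccontr)
  assume "\<not> b \<le> r"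
  then have q: "1 < b / r" using r by simp
  obtain n where n: "K + 1 < (b / r) ^ n" using real_arch_pow[OF q] by blast
  have "\<forall>\<^sub>F j in sequentially. K + 1 \<le> (b / r) ^ (2 ^ j)"
    using eventually_ge_at_top[of n]
  proof eventually_elim
    case (elim j)
    have "n \<le> 2 ^ j" using elim less_exp[of j] by linarith
    then have "(b / r) ^ n \<le> (b / r) ^ (2 ^ j)" using q by (intro power_increasing) auto
    then show ?case using n by linarith
  qed
  with ev have "\<forall>\<^sub>F j::nat in sequentially. False"
  proof eventually_elim
    case (elim j)
    then have "(K + 1) * r ^ (2 ^ j) \<le> K * r ^ (2 ^ j)"
      using r by (simp add: power_divide field_simps)
    then show ?case using zero_less_power[OF r, of "2 ^ j"] by (simp add: algebra_simps)
  qed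
  then show False by simp
qed

text \<open>Isolates what the spectral gap needs of the Mehler kernels. By \<open>k_square\<close>,
  two steps with parameter r make one step with r^2. In \<open>k_trace\<close> the 1 is the share of
  the constant functions, so \<open>K * r\<close> bounds what remains on mean-zero
  functions.\<close>

locale symmetric_markov_family = prob_space N for N :: "'a measure" +
  fixes k :: "real \<Rightarrow> 'a \<Rightarrow> 'a \<Rightarrow> real" and K :: real
  assumes k_measurable [measurable]: "0 < r \<Longrightarrow> r < 1 \<Longrightarrow> case_prod (k r) \<in> borel_measurable (N \<Otimes>\<^sub>M N)"
    and k_nonneg: "0 < r \<Longrightarrow> r < 1 \<Longrightarrow> 0 \<le> k r x y"
    and k_sym: "k r x y = k r y x"
    and k_markov: "0 < r \<Longrightarrow> r < 1 \<Longrightarrow> x \<in> space N \<Longrightarrow> (\<integral>\<^sup>+y. ennreal (k r x y) \<partial>N) = 1"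
    and k_square: "0 < r \<Longrightarrow> r < 1 \<Longrightarrow> x \<in> space N \<Longrightarrow> y \<in> space N \<Longrightarrow>
          (\<integral>\<^sup>+z. ennreal (k r x z * k r z y) \<partial>N) = ennreal (k (r\<^sup>2) x y)"
    and k_trace: "0 < r \<Longrightarrow> r \<le> 1/2 \<Longrightarrow> (\<integral>\<^sup>+x. ennreal (k r x x) \<partial>N) \<le> ennreal (1 + K * r)"
    and K_nonneg: "0 \<le> K"
begin

definition T :: "real \<Rightarrow> ('a \<Rightarrow> real) \<Rightarrow> 'a \<Rightarrow> real" where
  "T r \<psi> x = (\<integral>y. k r x y * \<psi> y \<partial>N)"

sublocale NN: pair_sigma_finite N N ..

context
  fixes r :: real
  assumes r: "0 < r" "r < 1"
begin

lemma r2: "0 < r\<^sup>2" "r\<^sup>2 < 1"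
  using r by (auto simp: power_less_one_iff abs_square_less_1)

lemma k_meas [measurable]: "case_prod (k r) \<in> borel_measurable (N \<Otimes>\<^sub>M N)"
  by (rule k_measurable[OF r])

lemma k_meas2 [measurable]: "case_prod (k (r\<^sup>2)) \<in> borel_measurable (N \<Otimes>\<^sub>M N)"
  by (rule k_measurable[OF r2])

lemma T_measurable [measurable]:
  assumes [measurable]: "\<psi> \<in> borel_measurable N"
  shows "T r \<psi> \<in> borel_measurable N"
  unfolding T_def[abs_def] by measurable

lemma k_integrable: "x \<in> space N \<Longrightarrow> integrable N (k r x)"
  by (rule integrableI_nonneg) (auto simp: k_nonneg r k_markov)

lemma k_integral: "x \<in> space N \<Longrightarrow> (\<integral>y. k r x y \<partial>N) = 1"
  by (subst integral_eq_nn_integral) (auto simp: k_nonneg r k_markov)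

lemma k_square_nn: "x \<in> space N \<Longrightarrow> (\<integral>\<^sup>+y. ennreal ((k r x y)\<^sup>2) \<partial>N) = ennreal (k (r\<^sup>2) x x)"
  using k_square[OF r, of x x] by (simp add: power2_eq_square k_sym[of r _ x])

lemma k_square_integrable: "x \<in> space N \<Longrightarrow> integrable N (\<lambda>y. (k r x y)\<^sup>2)"
  by (rule integrableI_nonneg) (auto simp: k_square_nn)

lemma k_square_integral: "x \<in> space N \<Longrightarrow> (\<integral>y. (k r x y)\<^sup>2 \<partial>N) = k (r\<^sup>2) x x"
  by (subst integral_eq_nn_integral) (auto simp: k_square_nn k_nonneg[OF r2])

lemma k_mult_integrable:
  assumes "\<psi> \<in> borel_measurable N" "integrable N (\<lambda>x. (\<psi> x)\<^sup>2)" "x \<in> space N"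
  shows "integrable N (\<lambda>y. k r x y * \<psi> y)"
  using assms by (intro integrable_mult_square k_square_integrable) auto

text \<open>Cauchy-Schwarz with the kernel split into two square roots bounds the square by the
  average of \<psi>^2; symmetry then turns the row normalisation into a column normalisation. The
  absolute value stays inside, so the same bound also justifies the Fubini exchange in
  \<open>T_selfadjoint\<close>.\<close>

lemma T_abs_square:
  assumes [measurable]: "\<psi> \<in> borel_measurable N"
  shows "(\<integral>\<^sup>+x. (\<integral>\<^sup>+y. ennreal (k r x y * \<bar>\<psi> y\<bar>) \<partial>N)\<^sup>2 \<partial>N) \<le> (\<integral>\<^sup>+y. ennreal ((\<psi> y)\<^sup>2) \<partial>N)"
proof -
  have "(\<integral>\<^sup>+y. ennreal (k r x y * \<bar>\<psi> y\<bar>) \<partial>N)\<^sup>2 \<le> (\<integral>\<^sup>+y. ennreal (k r x y * (\<psi> y)\<^sup>2) \<partial>N)"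
    if x[measurable]: "x \<in> space N" for x
  proof -
    have "(\<integral>\<^sup>+y. ennreal (k r x y * \<bar>\<psi> y\<bar>) \<partial>N)\<^sup>2
      = (\<integral>\<^sup>+y. ennreal (sqrt (k r x y)) * ennreal (sqrt (k r x y) * \<bar>\<psi> y\<bar>) \<partial>N)\<^sup>2"
      by (simp add: k_nonneg r flip: ennreal_mult mult.assoc)
    also have "\<dots> \<le> (\<integral>\<^sup>+y. (ennreal (sqrt (k r x y)))\<^sup>2 \<partial>N) * (\<integral>\<^sup>+y. (ennreal (sqrt (k r x y) * \<bar>\<psi> y\<bar>))\<^sup>2 \<partial>N)"
      by (rule Cauchy_Schwarz_nn_integral) auto
    also have "\<dots> = (\<integral>\<^sup>+y. ennreal (k r x y) \<partial>N) * (\<integral>\<^sup>+y. ennreal (k r x y * (\<psi> y)\<^sup>2) \<partial>N)"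
      by (simp add: ennreal_power power_mult_distrib k_nonneg r)
    finally show ?thesis by (simp add: k_markov r that)
  qed
  then have "(\<integral>\<^sup>+x. (\<integral>\<^sup>+y. ennreal (k r x y * \<bar>\<psi> y\<bar>) \<partial>N)\<^sup>2 \<partial>N) \<le> (\<integral>\<^sup>+x. (\<integral>\<^sup>+y. ennreal (k r x y * (\<psi> y)\<^sup>2) \<partial>N) \<partial>N)"
    by (rule nn_integral_mono)
  also have "\<dots> = (\<integral>\<^sup>+y. (\<integral>\<^sup>+x. ennreal (k r x y * (\<psi> y)\<^sup>2) \<partial>N) \<partial>N)"
    by (rule NN.Fubini') measurable
  also have "\<dots> = (\<integral>\<^sup>+y. (\<integral>\<^sup>+x. ennreal (k r y x) * ennreal ((\<psi> y)\<^sup>2) \<partial>N) \<partial>N)"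
    by (simp add: k_sym[of r] ennreal_mult k_nonneg r)
  also have "\<dots> = (\<integral>\<^sup>+y. ennreal ((\<psi> y)\<^sup>2) \<partial>N)"
    by (intro nn_integral_cong) (simp add: nn_integral_multc k_markov r)
  finally show ?thesis .
qed

text \<open>Where the kernel integral does not exist, \<open>T\<close> has the default value 0, so
  the bound holds at every x.\<close>

lemma T_le_abs:
  assumes [measurable]: "\<psi> \<in> borel_measurable N"
  shows "ennreal \<bar>T r \<psi> x\<bar> \<le> (\<integral>\<^sup>+y. ennreal (k r x y * \<bar>\<psi> y\<bar>) \<partial>N)"
proof -
  have "ennreal (norm (\<integral>y. k r x y * \<psi> y \<partial>N)) \<le> (\<integral>\<^sup>+y. ennreal (norm (k r x y * \<psi> y)) \<partial>N)"
    by (cases "integrable N (\<lambda>y. k r x y * \<psi> y)", rule integral_norm_bound_ennreal)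
       (simp_all add: not_integrable_integral_eq)
  then show ?thesis by (simp add: T_def abs_mult k_nonneg r)
qed

lemma T_square_integrable:
  assumes [measurable]: "\<psi> \<in> borel_measurable N" and "integrable N (\<lambda>x. (\<psi> x)\<^sup>2)"
  shows "integrable N (\<lambda>x. (T r \<psi> x)\<^sup>2)"
proof (rule integrableI_nonneg)
  have "(\<integral>\<^sup>+x. ennreal ((T r \<psi> x)\<^sup>2) \<partial>N) \<le> (\<integral>\<^sup>+x. (\<integral>\<^sup>+y. ennreal (k r x y * \<bar>\<psi> y\<bar>) \<partial>N)\<^sup>2 \<partial>N)"
  proof (rule nn_integral_mono)
    fix x
    show "ennreal ((T r \<psi> x)\<^sup>2) \<le> (\<integral>\<^sup>+y. ennreal (k r x y * \<bar>\<psi> y\<bar>) \<partial>N)\<^sup>2"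
      using power_mono[OF T_le_abs[OF assms(1), of x], of 2] by (simp add: ennreal_power)
  qed
  also have "\<dots> \<le> (\<integral>\<^sup>+y. ennreal ((\<psi> y)\<^sup>2) \<partial>N)" by (rule T_abs_square) simp
  also have "\<dots> < \<infinity>" using assms(2) by (simp add: nn_integral_eq_integral)
  finally show "(\<integral>\<^sup>+x. ennreal ((T r \<psi> x)\<^sup>2) \<partial>N) < \<infinity>" .
qed auto

text \<open>Fubini and \<open>k_square\<close>. The hypothesis \<open>k2\<close> is exactly the
  absolute convergence required: integrating the nonnegative kernels over the middle variable first
  leaves k(r^2) |\<psi>|.\<close>

lemma T_T:
  assumes [measurable]: "\<psi> \<in> borel_measurable N" and x: "x \<in> space N"
    and k2: "integrable N (\<lambda>z. k (r\<^sup>2) x z * \<psi> z)"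
  shows "T r (T r \<psi>) x = T (r\<^sup>2) \<psi> x"
proof -
  note [measurable] = x
  have "T r (T r \<psi>) x = (\<integral>y. (\<integral>z. k r x y * k r y z * \<psi> z \<partial>N) \<partial>N)"
    by (simp add: T_def mult.assoc)
  also have "\<dots> = (\<integral>z. (\<integral>y. k r x y * k r y z * \<psi> z \<partial>N) \<partial>N)"
  proof (rule NN.Fubini_integral_nn)
    have "(\<integral>\<^sup>+y. (\<integral>\<^sup>+z. ennreal \<bar>k r x y * k r y z * \<psi> z\<bar> \<partial>N) \<partial>N)
      = (\<integral>\<^sup>+z. (\<integral>\<^sup>+y. ennreal \<bar>k r x y * k r y z * \<psi> z\<bar> \<partial>N) \<partial>N)"
      by (rule NN.Fubini') measurable
    also have "\<dots> = (\<integral>\<^sup>+z. (\<integral>\<^sup>+y. ennreal (k r x y * k r y z) * ennreal \<bar>\<psi> z\<bar> \<partial>N) \<partial>N)"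
      by (intro nn_integral_cong) (simp add: abs_mult k_nonneg r flip: ennreal_mult)
    also have "\<dots> = (\<integral>\<^sup>+z. ennreal (norm (k (r\<^sup>2) x z * \<psi> z)) \<partial>N)"
      by (intro nn_integral_cong, subst nn_integral_multc)
         (simp_all add: k_square r x ennreal_mult[symmetric] k_nonneg[OF r2] abs_mult)
    also have "\<dots> < \<infinity>" using k2 unfolding integrable_iff_bounded by blast
    finally show "(\<integral>\<^sup>+y. (\<integral>\<^sup>+z. ennreal \<bar>k r x y * k r y z * \<psi> z\<bar> \<partial>N) \<partial>N) < \<infinity>" .
  qed measurable
  also have "\<dots> = (\<integral>z. (\<integral>y. k r x y * k r y z \<partial>N) * \<psi> z \<partial>N)" by simp
  also have "\<dots> = (\<integral>z. k (r\<^sup>2) x z * \<psi> z \<partial>N)"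
  proof (rule Bochner_Integration.integral_cong[OF refl])
    fix z assume z[measurable]: "z \<in> space N"
    have "(\<integral>y. k r x y * k r y z \<partial>N) = k (r\<^sup>2) x z"
      using k_square[OF r x z] by (subst integral_eq_nn_integral) (auto simp: k_nonneg[OF r] k_nonneg[OF r2])
    then show "(\<integral>y. k r x y * k r y z \<partial>N) * \<psi> z = k (r\<^sup>2) x z * \<psi> z" by simp
  qed
  finally show ?thesis by (simp add: T_def)
qed

lemma T_selfadjoint:
  assumes [measurable]: "\<psi> \<in> borel_measurable N" and \<psi>2: "integrable N (\<lambda>x. (\<psi> x)\<^sup>2)"
  shows "(\<integral>x. (T r \<psi> x)\<^sup>2 \<partial>N) = (\<integral>y. \<psi> y * T r (T r \<psi>) y \<partial>N)"
proof -
  have "(\<integral>x. (T r \<psi> x)\<^sup>2 \<partial>N) = (\<integral>x. (\<integral>y. T r \<psi> x * (k r x y * \<psi> y) \<partial>N) \<partial>N)"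
    by (simp add: power2_eq_square T_def[of r \<psi>])
  also have "\<dots> = (\<integral>y. (\<integral>x. T r \<psi> x * (k r x y * \<psi> y) \<partial>N) \<partial>N)"
  proof (rule NN.Fubini_integral_nn)
    have "(\<integral>\<^sup>+x. (\<integral>\<^sup>+y. ennreal \<bar>T r \<psi> x * (k r x y * \<psi> y)\<bar> \<partial>N) \<partial>N)
      = (\<integral>\<^sup>+x. ennreal \<bar>T r \<psi> x\<bar> * (\<integral>\<^sup>+y. ennreal (k r x y * \<bar>\<psi> y\<bar>) \<partial>N) \<partial>N)"
      by (intro nn_integral_cong) (simp add: abs_mult k_nonneg r ennreal_mult nn_integral_cmult)
    also have "\<dots> \<le> (\<integral>\<^sup>+x. (\<integral>\<^sup>+y. ennreal (k r x y * \<bar>\<psi> y\<bar>) \<partial>N)\<^sup>2 \<partial>N)"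
      by (intro nn_integral_mono) (auto simp: power2_eq_square intro!: mult_right_mono T_le_abs)
    also have "\<dots> \<le> (\<integral>\<^sup>+y. ennreal ((\<psi> y)\<^sup>2) \<partial>N)" by (rule T_abs_square) simp
    also have "\<dots> < \<infinity>" using \<psi>2 by (simp add: nn_integral_eq_integral)
    finally show "(\<integral>\<^sup>+x. (\<integral>\<^sup>+y. ennreal \<bar>T r \<psi> x * (k r x y * \<psi> y)\<bar> \<partial>N) \<partial>N) < \<infinity>" .
  qed measurable
  also have "\<dots> = (\<integral>y. (\<integral>x. \<psi> y * (k r y x * T r \<psi> x) \<partial>N) \<partial>N)"
    by (simp add: mult_ac k_sym[of r])
  also have "\<dots> = (\<integral>y. \<psi> y * T r (T r \<psi>) y \<partial>N)"
    by (simp add: T_def[of r "T r \<psi>"])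
  finally show ?thesis .
qed

end

text \<open>|T_r \<psi>|^2 = <\<psi>, T_(r^2) \<psi>>, then Cauchy-Schwarz. The parameter is squared
  while \<psi> stays the same, so the iteration can follow one function instead of an operator
  norm.\<close>

lemma T_doubling:
  assumes r: "0 < r" "r < 1"
    and [measurable]: "\<psi> \<in> borel_measurable N" and \<psi>2: "integrable N (\<lambda>x. (\<psi> x)\<^sup>2)"
  shows "(\<integral>x. (T r \<psi> x)\<^sup>2 \<partial>N)\<^sup>2 \<le> (\<integral>x. (\<psi> x)\<^sup>2 \<partial>N) * (\<integral>x. (T (r\<^sup>2) \<psi> x)\<^sup>2 \<partial>N)"
proof -
  note r2 = r2[OF r]
  have [measurable]: "T (r\<^sup>2) \<psi> \<in> borel_measurable N" by (rule T_measurable[OF r2]) simp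
  have "(\<integral>x. (T r \<psi> x)\<^sup>2 \<partial>N) = (\<integral>y. \<psi> y * T r (T r \<psi>) y \<partial>N)"
    by (rule T_selfadjoint[OF r assms(3) \<psi>2])
  also have "\<dots> = (\<integral>y. \<psi> y * T (r\<^sup>2) \<psi> y \<partial>N)"
    by (intro Bochner_Integration.integral_cong refl)
       (simp add: T_T[OF r assms(3)] k_mult_integrable[OF r2 assms(3) \<psi>2])
  finally show ?thesis
    using Cauchy_Schwarz_integral[OF assms(3) _ \<psi>2 T_square_integrable[OF r2 assms(3) \<psi>2]] by simp
qed

text \<open>On mean-zero functions the kernel may be replaced by \<open>k - 1\<close>, whose Hilbert--Schmidt norm is
  controlled by the trace of the squared kernel.\<close>
lemma T_Hilbert_Schmidt:
  assumes r: "0 < r" "r < 1" "r\<^sup>2 \<le> 1/2"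
    and [measurable]: "\<psi> \<in> borel_measurable N" and \<psi>2: "integrable N (\<lambda>x. (\<psi> x)\<^sup>2)"
    and mean: "(\<integral>x. \<psi> x \<partial>N) = 0"
  shows "(\<integral>x. (T r \<psi> x)\<^sup>2 \<partial>N) \<le> K * r\<^sup>2 * (\<integral>x. (\<psi> x)\<^sup>2 \<partial>N)"
proof -
  define a where "a = (\<integral>x. (\<psi> x)\<^sup>2 \<partial>N)"
  have a: "0 \<le> a" by (simp add: a_def)
  note r' = r(1,2) and r2 = r2[OF r(1,2)]
  note [measurable] = k_meas[OF r'] k_meas2[OF r'] T_measurable[OF r']
  have \<psi>1: "integrable N \<psi>" by (rule square_integrable_imp_integrable) (use \<psi>2 in auto)
  have pt: "(T r \<psi> x)\<^sup>2 \<le> a * (k (r\<^sup>2) x x - 1)" and ge: "1 \<le> k (r\<^sup>2) x x" if x[measurable]: "x \<in> space N" for x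
  proof -
    have sq: "(k r x y - 1)\<^sup>2 = (k r x y)\<^sup>2 - 2 * k r x y + 1" for y by (simp add: power2_diff)
    have ki: "integrable N (\<lambda>y. (k r x y - 1)\<^sup>2)"
      unfolding sq using k_square_integrable[OF r' x] k_integrable[OF r' x] by auto
    \<comment> \<open>Expanding the square gives k(r^2) x x - 2 + 1: \<open>k_square\<close> with
      symmetry evaluates the first term, the Markov property the second.\<close>
    have kv: "(\<integral>y. (k r x y - 1)\<^sup>2 \<partial>N) = k (r\<^sup>2) x x - 1"
      unfolding sq using k_square_integrable[OF r' x] k_integrable[OF r' x]
      by (simp add: k_square_integral[OF r' x] k_integral[OF r' x] prob_space)
    have "T r \<psi> x = (\<integral>y. (k r x y - 1) * \<psi> y \<partial>N)"
      using k_mult_integrable[OF r' assms(4) \<psi>2 x] \<psi>1 by (simp add: T_def left_diff_distrib mean)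
    then show "(T r \<psi> x)\<^sup>2 \<le> a * (k (r\<^sup>2) x x - 1)"
      using Cauchy_Schwarz_integral[OF _ assms(4) ki \<psi>2] kv by (simp add: a_def mult.commute)
    have "0 \<le> (\<integral>y. (k r x y - 1)\<^sup>2 \<partial>N)" by simp
    then show "1 \<le> k (r\<^sup>2) x x" unfolding kv by simp
  qed
  have tr: "(\<integral>\<^sup>+x. ennreal (k (r\<^sup>2) x x) \<partial>N) \<le> ennreal (1 + K * r\<^sup>2)"
    by (rule k_trace) (use r2 r in auto)
  have ki: "integrable N (\<lambda>x. k (r\<^sup>2) x x)"
    by (rule integrableI_nonneg) (use tr k_nonneg[OF r2] in \<open>auto intro: le_less_trans\<close>)
  have "ennreal (\<integral>x. k (r\<^sup>2) x x \<partial>N) \<le> ennreal (1 + K * r\<^sup>2)"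
    using tr k_nonneg[OF r2] by (subst nn_integral_eq_integral[symmetric, OF ki]) auto
  then have "(\<integral>x. k (r\<^sup>2) x x \<partial>N) \<le> 1 + K * r\<^sup>2"
    by (subst (asm) ennreal_le_iff) (auto simp: K_nonneg)
  moreover have "(\<integral>x. (T r \<psi> x)\<^sup>2 \<partial>N) \<le> (\<integral>x. a * (k (r\<^sup>2) x x - 1) \<partial>N)"
    by (rule integral_mono[OF T_square_integrable[OF r' assms(4) \<psi>2]]) (use ki pt in auto)
  moreover have "(\<integral>x. a * (k (r\<^sup>2) x x - 1) \<partial>N) = a * ((\<integral>x. k (r\<^sup>2) x x \<partial>N) - 1)"
    using ki by (simp add: prob_space)
  ultimately have "(\<integral>x. (T r \<psi> x)\<^sup>2 \<partial>N) \<le> a * (1 + K * r\<^sup>2 - 1)"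
    using a by (smt (verit) mult_left_mono)
  then show ?thesis by (simp add: a_def mult_ac)
qed

text \<open>For one fixed \<psi> the ratio \<open>b r / a\<close> plays the part of the squared
  norm: doubling bounds its 2^j-th power by the ratio at r^(2^j), where the Hilbert-Schmidt estimate
  applies. The zero mean enters through that estimate.\<close>

theorem spectral_gap:
  assumes r: "0 < r" "r < 1"
    and [measurable]: "\<psi> \<in> borel_measurable N" and \<psi>2: "integrable N (\<lambda>x. (\<psi> x)\<^sup>2)"
    and mean: "(\<integral>x. \<psi> x \<partial>N) = 0"
  shows "(\<integral>x. (T r \<psi> x)\<^sup>2 \<partial>N) \<le> r\<^sup>2 * (\<integral>x. (\<psi> x)\<^sup>2 \<partial>N)"
proof -
  define a where "a = (\<integral>x. (\<psi> x)\<^sup>2 \<partial>N)"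
  define b where "b r = (\<integral>x. (T r \<psi> x)\<^sup>2 \<partial>N)" for r
  have a: "0 \<le> a" and b: "0 \<le> b r" for r by (auto simp: a_def b_def)
  have dbl: "(b s)\<^sup>2 \<le> a * b (s\<^sup>2)" if "0 < s" "s < 1" for s
    using T_doubling[OF that assms(3) \<psi>2] by (simp add: a_def b_def)
  show ?thesis
  proof (cases "a = 0")
    case True
    then have "b r = 0" using dbl[OF r] by simp
    then show ?thesis using True by (simp add: a_def b_def)
  next
    case False
    with a have a: "0 < a" by simp
    have rj: "0 < r ^ 2 ^ j" "r ^ 2 ^ j < 1" for j :: nat using r by (auto simp: power_less_one_iff)
    have it: "(b r / a) ^ (2 ^ j) \<le> b (r ^ 2 ^ j) / a" for j :: nat
    proof (induction j)
      case 0
      then show ?case by simp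
    next
      case (Suc j)
      have "(b r / a) ^ (2 ^ Suc j) = ((b r / a) ^ (2 ^ j))\<^sup>2"
        by (simp add: power_mult[symmetric] mult.commute)
      also have "\<dots> \<le> (b (r ^ 2 ^ j) / a)\<^sup>2"
        using Suc b a by (intro power_mono) auto
      also have "\<dots> \<le> a * b ((r ^ 2 ^ j)\<^sup>2) / a\<^sup>2"
        using dbl[OF rj] a by (simp add: power_divide divide_right_mono)
      also have "(r ^ 2 ^ j)\<^sup>2 = r ^ 2 ^ Suc j"
        by (simp add: power_mult[symmetric] mult.commute)
      finally show ?case using a by (simp add: power2_eq_square)
    qed
    \<comment> \<open>The exponent is 2^(j+1) and not 2^j: the Hilbert-Schmidt estimate at r^(2^j)
      calls the trace bound at its square, which must be at most 1/2.\<close>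
    have "(\<lambda>n. r ^ n) \<longlonglongrightarrow> 0" using r by (intro LIMSEQ_realpow_zero) auto
    moreover have "filterlim (\<lambda>j. (2::nat) ^ Suc j) at_top sequentially"
      by (rule filterlim_subseq) (simp add: strict_mono_def)
    ultimately have "(\<lambda>j. r ^ 2 ^ Suc j) \<longlonglongrightarrow> 0"
      by (rule filterlim_compose)
    then have "\<forall>\<^sub>F j in sequentially. r ^ 2 ^ Suc j < 1/2"
      by (rule order_tendstoD) simp
    then have "\<forall>\<^sub>F j in sequentially. (b r / a) ^ (2 ^ j) \<le> K * (r\<^sup>2) ^ (2 ^ j)"
    proof eventually_elim
      case (elim j)
      have e: "(r ^ 2 ^ j)\<^sup>2 = (r\<^sup>2) ^ (2 ^ j)" by (simp add: power_mult[symmetric] mult.commute)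
      have e': "(r ^ 2 ^ j)\<^sup>2 = r ^ 2 ^ Suc j" by (simp add: power_mult[symmetric] mult.commute)
      have "b (r ^ 2 ^ j) \<le> K * (r ^ 2 ^ j)\<^sup>2 * a"
        using T_Hilbert_Schmidt[OF rj _ assms(3) \<psi>2 mean, of j] elim unfolding e'
        by (simp add: a_def b_def)
      then have "b (r ^ 2 ^ j) / a \<le> K * (r ^ 2 ^ j)\<^sup>2"
        using a by (simp add: field_simps)
      with it[of j] show ?case unfolding e by linarith
    qed
    then have "b r / a \<le> r\<^sup>2"
      by (intro le_of_power_le_bounded[of "r\<^sup>2" _ K]) (use r in auto)
    then show ?thesis using a by (simp add: a_def b_def field_simps)
  qed
qed

end

section \<open>The Mehler kernel and Gaussian transition kernels\<close>

lemma det_scaleR: "det (c *\<^sub>R A) = c ^ CARD('n) * det A" for A :: "real^'n^'n"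
proof -
  have "c *\<^sub>R A = mat c ** A"
    by (simp add: matrix_matrix_mult_def mat_def vec_eq_iff if_distrib if_distribR cong: if_cong)
  moreover have "det (mat c :: real^'n^'n) = c ^ CARD('n)"
    by (metis matrix_scaleR det_matrix_scaleR)
  ultimately show ?thesis by (simp add: det_mul)
qed

lemma matrix_inv_scaleR:
  fixes A :: "real^'n^'n"
  assumes "invertible A" "c \<noteq> 0"
  shows "matrix_inv (c *\<^sub>R A) = (1 / c) *\<^sub>R matrix_inv A"
  by (rule matrix_inv_eqI) (simp add: assms matrix_scalar_ac matrix_inv_mult)

text \<open>The tilt replaces the inverse covariance W by (1 + \<beta>) W and moves the centre, so
  the integral is again Gaussian as long as \<beta> > -1. A positive \<beta> serves the composition
  of two Mehler kernels, a negative one their trace.\<close>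

lemma nn_integral_gaussian_measure_exp_quadratic:
  fixes Q :: "real^'n^'n"
  assumes Q: "pos_def Q" and \<beta>: "\<beta> > -1"
  defines "W \<equiv> matrix_inv Q"
  shows "(\<integral>\<^sup>+z. ennreal (exp (- \<beta> * ((z - m) \<bullet> (W *v (z - m))) / 2 + b \<bullet> (W *v (z - m)))) \<partial>gaussian_measure m Q)
    = ennreal (exp (b \<bullet> (W *v b) / (2 * (1 + \<beta>))) / sqrt ((1 + \<beta>) ^ CARD('n)))"
proof -
  define \<alpha> where "\<alpha> = 1 + \<beta>"
  have \<alpha>: "\<alpha> > 0" using \<beta> by (simp add: \<alpha>_def)
  have W: "pos_def W" unfolding W_def by (rule pos_def_matrix_inv[OF Q])
  have \<alpha>W: "pos_def (\<alpha> *\<^sub>R W)" using W \<alpha> by (rule pos_def_mult)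
  define D where "D = sqrt ((2 * pi) ^ CARD('n) * det Q)"
  have D: "D > 0" using pos_def_det_pos[OF Q] by (simp add: D_def)
  define c where "c = m + (1 / \<alpha>) *\<^sub>R b"
  have sq: "- ((z - m) \<bullet> (W *v (z - m))) / 2 + (- \<beta> * ((z - m) \<bullet> (W *v (z - m))) / 2 + b \<bullet> (W *v (z - m)))
    = b \<bullet> (W *v b) / (2 * \<alpha>) + - ((z - c) \<bullet> ((\<alpha> *\<^sub>R W) *v (z - c))) / 2" for z
  proof -
    define u where "u = z - m"
    have zc: "z - c = u - (1 / \<alpha>) *\<^sub>R b" by (simp add: u_def c_def)
    have sym: "u \<bullet> (W *v b) = b \<bullet> (W *v u)" by (rule pos_def_sym[OF W])
    have "(z - c) \<bullet> ((\<alpha> *\<^sub>R W) *v (z - c)) = \<alpha> * (u \<bullet> (W *v u) - 2 * (1 / \<alpha>) * (b \<bullet> (W *v u)) + (1 / \<alpha>)\<^sup>2 * (b \<bullet> (W *v b)))"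
      unfolding zc scaleR_matrix_vector_assoc[symmetric] using \<alpha>
      by (simp add: matrix_vector_mult_diff_distrib matrix_vector_mult_scaleR inner_diff_left inner_diff_right sym power2_eq_square)
         (simp add: field_simps)
    also have "\<dots> = \<alpha> * (u \<bullet> (W *v u)) - 2 * (b \<bullet> (W *v u)) + b \<bullet> (W *v b) / \<alpha>"
      using \<alpha> by (simp add: field_simps power2_eq_square)
    finally show ?thesis using \<alpha> unfolding u_def[symmetric] by (simp add: \<alpha>_def field_simps)
  qed
  have pt: "ennreal (gaussian_density m Q z) * ennreal (exp (- \<beta> * ((z - m) \<bullet> (W *v (z - m))) / 2 + b \<bullet> (W *v (z - m))))
    = ennreal (exp (b \<bullet> (W *v b) / (2 * \<alpha>)) / D) * ennreal (exp (- ((z - c) \<bullet> ((\<alpha> *\<^sub>R W) *v (z - c))) / 2))" for z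
  proof -
    have "gaussian_density m Q z * exp (- \<beta> * ((z - m) \<bullet> (W *v (z - m))) / 2 + b \<bullet> (W *v (z - m)))
      = exp (b \<bullet> (W *v b) / (2 * \<alpha>)) / D * exp (- ((z - c) \<bullet> ((\<alpha> *\<^sub>R W) *v (z - c))) / 2)"
      unfolding gaussian_density_def W_def[symmetric] D_def[symmetric] times_divide_eq_left exp_add[symmetric] sq ..
    then show ?thesis
      using gaussian_density_pos[OF Q, of m z] D by (subst (1 2) ennreal_mult[symmetric]) auto
  qed
  have "(\<integral>\<^sup>+z. ennreal (exp (- \<beta> * ((z - m) \<bullet> (W *v (z - m))) / 2 + b \<bullet> (W *v (z - m)))) \<partial>gaussian_measure m Q)
    = (\<integral>\<^sup>+z. ennreal (gaussian_density m Q z) * ennreal (exp (- \<beta> * ((z - m) \<bullet> (W *v (z - m))) / 2 + b \<bullet> (W *v (z - m)))) \<partial>lborel)"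
    by (rule nn_integral_gaussian_measure) measurable
  also have "\<dots> = ennreal (exp (b \<bullet> (W *v b) / (2 * \<alpha>)) / D) * ennreal (sqrt ((2 * pi) ^ CARD('n) / det (\<alpha> *\<^sub>R W)))"
    unfolding pt by (subst nn_integral_cmult, measurable, subst nn_integral_gaussian[OF \<alpha>W]) simp
  also have "\<dots> = ennreal (exp (b \<bullet> (W *v b) / (2 * \<alpha>)) / D * sqrt ((2 * pi) ^ CARD('n) / det (\<alpha> *\<^sub>R W)))"
    using D pos_def_det_pos[OF \<alpha>W] by (subst ennreal_mult[symmetric]) auto
  also have "sqrt ((2 * pi) ^ CARD('n) / det (\<alpha> *\<^sub>R W)) = D / sqrt (\<alpha> ^ CARD('n))"
    using pos_def_det_pos[OF Q] \<alpha>
    by (simp add: D_def det_scaleR W_def det_matrix_inv[OF pos_def_invertible[OF Q]] real_sqrt_divide real_sqrt_mult)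
  finally show ?thesis using D by (simp add: \<alpha>_def)
qed

text \<open>The density of \<open>N(r x + (1 - r) m, (1 - r\<^sup>2) Q)\<close> with respect to \<open>N(m, Q)\<close>.\<close>
definition mehler_kernel :: "real^'n \<Rightarrow> real^'n^'n \<Rightarrow> real \<Rightarrow> real^'n \<Rightarrow> real^'n \<Rightarrow> real" where
  "mehler_kernel m Q r x y =
     exp (- (r\<^sup>2 * ((x - m) \<bullet> (matrix_inv Q *v (x - m))) + r\<^sup>2 * ((y - m) \<bullet> (matrix_inv Q *v (y - m)))
            - 2 * r * ((x - m) \<bullet> (matrix_inv Q *v (y - m)))) / (2 * (1 - r\<^sup>2)))
     / sqrt ((1 - r\<^sup>2) ^ CARD('n))"

text \<open>With q = 1 - r^2, taking out the density of N(m, Q) leaves the coefficient 1/q - 1 =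
  r^2/q on the square in y, equal to that of the square in x; this is why the kernel is
  symmetric.\<close>

lemma gaussian_density_mehler_kernel:
  fixes Q :: "real^'n^'n"
  assumes Q: "pos_def Q" and r: "0 < r" "r < 1"
  shows "gaussian_density (r *\<^sub>R x + (1 - r) *\<^sub>R m) ((1 - r\<^sup>2) *\<^sub>R Q) y = gaussian_density m Q y * mehler_kernel m Q r x y"
proof -
  define W where "W = matrix_inv Q"
  have W: "pos_def W" unfolding W_def by (rule pos_def_matrix_inv[OF Q])
  define q where "q = 1 - r\<^sup>2"
  have q: "q > 0" using r by (simp add: q_def power_less_one_iff abs_square_less_1)
  define u v where "u = x - m" and "v = y - m"
  have e: "y - (r *\<^sub>R x + (1 - r) *\<^sub>R m) = v - r *\<^sub>R u" by (simp add: u_def v_def algebra_simps)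
  have inv: "matrix_inv (q *\<^sub>R Q) = (1 / q) *\<^sub>R W"
    unfolding W_def by (rule matrix_inv_scaleR[OF pos_def_invertible[OF Q]]) (use q in simp)
  have sym: "v \<bullet> (W *v u) = u \<bullet> (W *v v)" by (rule pos_def_sym[OF W])
  have "(v - r *\<^sub>R u) \<bullet> (((1 / q) *\<^sub>R W) *v (v - r *\<^sub>R u)) = (v \<bullet> (W *v v) - 2 * r * (u \<bullet> (W *v v)) + r\<^sup>2 * (u \<bullet> (W *v u))) / q"
    unfolding scaleR_matrix_vector_assoc[symmetric]
    by (simp add: matrix_vector_mult_diff_distrib matrix_vector_mult_scaleR inner_diff_left inner_diff_right sym power2_eq_square)
       (simp add: algebra_simps)
  also have "\<dots> = v \<bullet> (W *v v) + (r\<^sup>2 * (u \<bullet> (W *v u)) + r\<^sup>2 * (v \<bullet> (W *v v)) - 2 * r * (u \<bullet> (W *v v))) / q"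
    using q by (simp add: field_simps) (simp add: q_def algebra_simps)
  finally have ex: "- ((v - r *\<^sub>R u) \<bullet> (((1 / q) *\<^sub>R W) *v (v - r *\<^sub>R u))) / 2 = - (v \<bullet> (W *v v)) / 2 +
      - (r\<^sup>2 * (u \<bullet> (W *v u)) + r\<^sup>2 * (v \<bullet> (W *v v)) - 2 * r * (u \<bullet> (W *v v))) / (2 * q)"
    using q by (simp add: field_simps)
  have "sqrt ((2 * pi) ^ CARD('n) * det (q *\<^sub>R Q)) = sqrt ((2 * pi) ^ CARD('n) * det Q) * sqrt (q ^ CARD('n))"
    by (simp add: det_scaleR flip: real_sqrt_mult)
  then show ?thesis
    unfolding gaussian_density_def mehler_kernel_def q_def[symmetric] u_def[symmetric] v_def[symmetric] W_def[symmetric]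
      e inv ex exp_add by simp
qed

text \<open>The Markov property is the normalisation of a Gaussian density; composition and trace
  are both instances of the exponential-quadratic integral. The trace equals (1 - r)^(-n), and the
  last argument is the constant of its linear bound on (0, 1/2].\<close>

lemma mehler_kernel_markov:
  fixes Q :: "real^'n^'n"
  assumes Q: "pos_def Q"
  shows "symmetric_markov_family (gaussian_measure m Q) (mehler_kernel m Q) (CARD('n) * 2 ^ CARD('n))"
proof -
  interpret prob_space "gaussian_measure m Q" by (rule prob_space_gaussian_measure[OF Q])
  define W where "W = matrix_inv Q"
  have W: "pos_def W" unfolding W_def by (rule pos_def_matrix_inv[OF Q])
  note sym = pos_def_sym[OF W]
  define n where "n = CARD('n)"
  have q: "0 < 1 - r\<^sup>2" if "0 < r" "r < 1" for r :: real
    using that by (simp add: power_less_one_iff abs_square_less_1)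
  note mgf = nn_integral_gaussian_measure_exp_quadratic[OF Q, folded W_def n_def]
  note kdef = mehler_kernel_def[where Q=Q, folded W_def n_def]
  show ?thesis
  proof
    fix r :: real assume r: "0 < r" "r < 1"
    show "case_prod (mehler_kernel m Q r) \<in> borel_measurable (gaussian_measure m Q \<Otimes>\<^sub>M gaussian_measure m Q)"
      unfolding mehler_kernel_def by measurable
    fix x y :: "real^'n"
    show "0 \<le> mehler_kernel m Q r x y" using q[OF r] by (simp add: mehler_kernel_def)
    show "(\<integral>\<^sup>+y. ennreal (mehler_kernel m Q r x y) \<partial>gaussian_measure m Q) = 1"
    proof -
      have "(\<integral>\<^sup>+y. ennreal (mehler_kernel m Q r x y) \<partial>gaussian_measure m Q)
        = (\<integral>\<^sup>+y. ennreal (gaussian_density m Q y) * ennreal (mehler_kernel m Q r x y) \<partial>lborel)"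
        by (rule nn_integral_gaussian_measure) (unfold mehler_kernel_def, measurable)
      also have "\<dots> = (\<integral>\<^sup>+y. ennreal (gaussian_density (r *\<^sub>R x + (1 - r) *\<^sub>R m) ((1 - r\<^sup>2) *\<^sub>R Q) y) \<partial>lborel)"
        using gaussian_density_pos[OF Q] q[OF r]
        by (intro nn_integral_cong) (simp add: gaussian_density_mehler_kernel[OF Q r] ennreal_mult' less_imp_le)
      also have "\<dots> = 1" by (rule nn_integral_gaussian_density[OF pos_def_mult[OF Q q[OF r]]])
      finally show ?thesis .
    qed
    show "(\<integral>\<^sup>+z. ennreal (mehler_kernel m Q r x z * mehler_kernel m Q r z y) \<partial>gaussian_measure m Q)
      = ennreal (mehler_kernel m Q (r\<^sup>2) x y)"
    proof -
      define u v where "u = x - m" and "v = y - m"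
      define p where "p = 1 - r\<^sup>2"
      \<comment> \<open>Adding the two exponents in w = z - m: each contributes -r^2/(2p) to the
        square, hence \<beta>/2 = r^2/p, and the cross terms combine to the linear coefficient (r/p)
        (u + v).\<close>
      define \<beta> where "\<beta> = 2 * r\<^sup>2 / p"
      define b where "b = (r / p) *\<^sub>R (u + v)"
      have p: "p > 0" using q[OF r] by (simp add: p_def)
      define c where "c = - r\<^sup>2 * (u \<bullet> (W *v u) + v \<bullet> (W *v v)) / (2 * p)"
      \<comment> \<open>These two factorisations give p^2 (1 + \<beta>) = 1 - r^4, the normalisation
        at parameter r^2.\<close>
      have b1: "1 + \<beta> = (1 + r\<^sup>2) / p" using p by (simp add: \<beta>_def field_simps) (simp add: p_def)
      have p1: "1 - (r\<^sup>2)\<^sup>2 = p * (1 + r\<^sup>2)" by (simp add: p_def algebra_simps power2_eq_square)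
      have "\<beta> > -1" using p by (smt (verit) \<beta>_def divide_nonneg_pos zero_le_power2)
      have pt: "mehler_kernel m Q r x z * mehler_kernel m Q r z y
        = exp c / p ^ n * exp (- \<beta> * ((z - m) \<bullet> (W *v (z - m))) / 2 + b \<bullet> (W *v (z - m)))" for z
      proof -
        define w where "w = z - m"
        have s: "w \<bullet> (W *v v) = v \<bullet> (W *v w)" by (rule sym)
        have "- (r\<^sup>2 * (u \<bullet> (W *v u)) + r\<^sup>2 * (w \<bullet> (W *v w)) - 2 * r * (u \<bullet> (W *v w))) / (2 * p)
          + - (r\<^sup>2 * (w \<bullet> (W *v w)) + r\<^sup>2 * (v \<bullet> (W *v v)) - 2 * r * (w \<bullet> (W *v v))) / (2 * p)
          = c + (- \<beta> * (w \<bullet> (W *v w)) / 2 + b \<bullet> (W *v w))"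
          using p by (simp add: c_def \<beta>_def b_def s inner_add_left field_simps)
        then show ?thesis
          using p unfolding kdef p_def[symmetric] u_def[symmetric] v_def[symmetric] w_def[symmetric]
          by (simp add: exp_add[symmetric] flip: real_sqrt_mult)
      qed
      have "(\<integral>\<^sup>+z. ennreal (mehler_kernel m Q r x z * mehler_kernel m Q r z y) \<partial>gaussian_measure m Q)
        = (\<integral>\<^sup>+z. ennreal (exp c / p ^ n) * ennreal (exp (- \<beta> * ((z - m) \<bullet> (W *v (z - m))) / 2 + b \<bullet> (W *v (z - m)))) \<partial>gaussian_measure m Q)"
        unfolding pt using p by (intro nn_integral_cong ennreal_mult) auto
      also have "\<dots> = ennreal (exp c / p ^ n) * ennreal (exp (b \<bullet> (W *v b) / (2 * (1 + \<beta>))) / sqrt ((1 + \<beta>) ^ n))"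
        by (subst nn_integral_cmult, measurable, subst mgf[OF \<open>\<beta> > -1\<close>]) simp
      also have "\<dots> = ennreal (exp (c + b \<bullet> (W *v b) / (2 * (1 + \<beta>))) / (p ^ n * sqrt ((1 + \<beta>) ^ n)))"
        using p \<open>\<beta> > -1\<close> by (subst ennreal_mult[symmetric]) (auto simp: exp_add)
      also have "p ^ n * sqrt ((1 + \<beta>) ^ n) = sqrt ((1 - (r\<^sup>2)\<^sup>2) ^ n)"
      proof -
        have "p ^ n = sqrt ((p\<^sup>2) ^ n)" using p by (simp add: real_sqrt_power)
        then have "p ^ n * sqrt ((1 + \<beta>) ^ n) = sqrt ((p\<^sup>2 * (1 + \<beta>)) ^ n)"
          by (simp add: real_sqrt_mult power_mult_distrib)
        also have "p\<^sup>2 * (1 + \<beta>) = 1 - (r\<^sup>2)\<^sup>2" unfolding b1 p1 using p by (simp add: power2_eq_square)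
        finally show ?thesis .
      qed
      also have "c + b \<bullet> (W *v b) / (2 * (1 + \<beta>)) = - ((r\<^sup>2)\<^sup>2 * (u \<bullet> (W *v u)) + (r\<^sup>2)\<^sup>2 * (v \<bullet> (W *v v)) - 2 * r\<^sup>2 * (u \<bullet> (W *v v))) / (2 * (1 - (r\<^sup>2)\<^sup>2))"
      proof -
        have s: "1 + r\<^sup>2 \<noteq> 0" using zero_le_power2[of r] by linarith
        define X Y Z where "X = u \<bullet> (W *v u)" and "Y = v \<bullet> (W *v v)" and "Z = u \<bullet> (W *v v)"
        have "b \<bullet> (W *v b) = (r / p)\<^sup>2 * (X + Y + 2 * Z)"
          by (simp add: b_def X_def Y_def Z_def matrix_vector_right_distrib matrix_vector_mult_scaleR inner_add_left inner_add_right sym[of v u] power2_eq_square algebra_simps)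
        then have "c + b \<bullet> (W *v b) / (2 * (1 + \<beta>)) = - r\<^sup>2 * (X + Y) / (2 * p) + (r / p)\<^sup>2 * (X + Y + 2 * Z) / (2 * ((1 + r\<^sup>2) / p))"
          by (simp add: c_def b1 X_def Y_def)
        also have "(r / p)\<^sup>2 * (X + Y + 2 * Z) / (2 * ((1 + r\<^sup>2) / p)) = r\<^sup>2 * (X + Y + 2 * Z) / (2 * (p * (1 + r\<^sup>2)))"
          using p by (simp add: power2_eq_square)
        also have "- r\<^sup>2 * (X + Y) / (2 * p) = - r\<^sup>2 * (X + Y) * (1 + r\<^sup>2) / (2 * (p * (1 + r\<^sup>2)))"
          using nonzero_mult_divide_mult_cancel_right[of "1 + r\<^sup>2" "- r\<^sup>2 * (X + Y)" "2 * p"] s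
          by (simp only: mult.assoc not_False_eq_True)
        also have "- r\<^sup>2 * (X + Y) * (1 + r\<^sup>2) / (2 * (p * (1 + r\<^sup>2))) + r\<^sup>2 * (X + Y + 2 * Z) / (2 * (p * (1 + r\<^sup>2)))
          = - ((r\<^sup>2)\<^sup>2 * X + (r\<^sup>2)\<^sup>2 * Y - 2 * r\<^sup>2 * Z) / (2 * (p * (1 + r\<^sup>2)))"
          unfolding add_divide_distrib[symmetric] by (rule arg_cong2[where f="(/)"]) (simp_all add: algebra_simps power2_eq_square)
        finally show ?thesis unfolding p1 X_def Y_def Z_def .
      qed
      finally show ?thesis by (simp add: kdef u_def v_def)
    qed
  next
    fix r :: real and x y :: "real^'n"
    show "mehler_kernel m Q r x y = mehler_kernel m Q r y x"
      unfolding kdef by (simp add: sym[of "y - m" "x - m"] add.commute)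
  next
    fix r :: real assume r: "0 < r" "r \<le> 1/2"
    show "(\<integral>\<^sup>+x. ennreal (mehler_kernel m Q r x x) \<partial>gaussian_measure m Q) \<le> ennreal (1 + CARD('n) * 2 ^ CARD('n) * r)"
    proof -
      define p where "p = 1 - r\<^sup>2"
      have p: "p > 0" using q[of r] r by (simp add: p_def)
      \<comment> \<open>On the diagonal the exponent is r (1 - r) X / p = r X / (1 + r), which grows
        with X; so \<beta> is negative, yet 1 + \<beta> = (1 - r) / (1 + r) stays positive.\<close>
      define \<beta> where "\<beta> = - 2 * r / (1 + r)"
      have b1: "1 + \<beta> = (1 - r) / (1 + r)" using r by (simp add: \<beta>_def field_simps)
      have "0 < 1 + \<beta>" unfolding b1 using r by simp
      then have \<beta>: "\<beta> > -1" by simp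
      have pr: "p = (1 - r) * (1 + r)" by (simp add: p_def algebra_simps power2_eq_square)
      have pt: "mehler_kernel m Q r x x = 1 / sqrt (p ^ n) * exp (- \<beta> * ((x - m) \<bullet> (W *v (x - m))) / 2 + 0 \<bullet> (W *v (x - m)))" for x
      proof -
        define X where "X = (x - m) \<bullet> (W *v (x - m))"
        have "- (r\<^sup>2 * X + r\<^sup>2 * X - 2 * r * X) / (2 * p) = - \<beta> * X / 2"
          using r unfolding pr \<beta>_def by (simp add: divide_simps power2_eq_square) (simp add: algebra_simps)
        then show ?thesis by (simp add: kdef p_def[symmetric] X_def[symmetric])
      qed
      have "(\<integral>\<^sup>+x. ennreal (mehler_kernel m Q r x x) \<partial>gaussian_measure m Q)
        = (\<integral>\<^sup>+x. ennreal (1 / sqrt (p ^ n)) * ennreal (exp (- \<beta> * ((x - m) \<bullet> (W *v (x - m))) / 2 + 0 \<bullet> (W *v (x - m)))) \<partial>gaussian_measure m Q)"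
        unfolding pt using p by (intro nn_integral_cong ennreal_mult) auto
      also have "\<dots> = ennreal (1 / sqrt (p ^ n)) * ennreal (exp (0 \<bullet> (W *v 0) / (2 * (1 + \<beta>))) / sqrt ((1 + \<beta>) ^ n))"
        by (subst nn_integral_cmult, measurable, subst mgf[OF \<beta>]) simp
      also have "\<dots> = ennreal (1 / (sqrt (p ^ n) * sqrt ((1 + \<beta>) ^ n)))"
        using p \<beta> by (subst ennreal_mult[symmetric]) auto
      also have "sqrt (p ^ n) * sqrt ((1 + \<beta>) ^ n) = (1 - r) ^ n"
      proof -
        have "sqrt (p ^ n) * sqrt ((1 + \<beta>) ^ n) = sqrt ((p * (1 + \<beta>)) ^ n)"
          by (simp add: real_sqrt_mult power_mult_distrib)
        also have "p * (1 + \<beta>) = (1 - r)\<^sup>2" unfolding b1 pr using r by (simp add: power2_eq_square)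
        also have "sqrt (((1 - r)\<^sup>2) ^ n) = (1 - r) ^ n"
          using r by (simp add: real_sqrt_power)
        finally show ?thesis .
      qed
      also have "1 / (1 - r) ^ n \<le> 1 + n * 2 ^ n * r"
      proof -
        \<comment> \<open>Bernoulli bounds 1 - (1 - r)^n by n r, and dividing by (1 - r)^n costs at
          most 2^n because r <= 1/2.\<close>
        have "1 + real n * (- r) \<le> (1 + (- r)) ^ n" by (rule Bernoulli_inequality) (use r in simp)
        then have B: "1 - (1 - r) ^ n \<le> n * r" by simp
        have "(1/2) ^ n \<le> (1 - r) ^ n" by (rule power_mono) (use r in auto)
        then have "1 \<le> 2 ^ n * (1 - r) ^ n" by (simp add: power_divide field_simps)
        then have "n * r * 1 \<le> n * r * (2 ^ n * (1 - r) ^ n)" using r by (intro mult_left_mono) auto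
        with B have "1 \<le> (1 + n * 2 ^ n * r) * (1 - r) ^ n" by (simp add: algebra_simps)
        then show ?thesis using r by (simp add: divide_le_eq)
      qed
      finally show ?thesis by (simp add: n_def ennreal_leI)
    qed
  qed (simp_all)
qed

lemma integral_gaussian_measure:
  fixes h :: "real^'n \<Rightarrow> real"
  assumes "pos_def Q" and [measurable]: "h \<in> borel_measurable borel"
  shows "(\<integral>x. h x \<partial>gaussian_measure m Q) = (\<integral>x. gaussian_density m Q x * h x \<partial>lborel)"
  unfolding gaussian_measure_density using gaussian_density_pos[OF assms(1)]
  by (subst integral_density) (auto simp: less_imp_le)

text \<open>Signed version of \<open>nn_integral_gaussian_measure_compose\<close>; that lemma
  applied to |h| supplies the absolute convergence for Fubini.\<close>

lemma integral_gaussian_measure_compose: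
  fixes L Q0 Q1 :: "real^'n^'n" and h :: "real^'n \<Rightarrow> real"
  assumes Q0: "pos_def Q0" and Q1: "pos_def Q1" and L: "det L \<noteq> 0"
    and int: "integrable (gaussian_measure (L *v m + a) (L ** Q0 ** transpose L + Q1)) h"
  shows "(\<integral>x. (\<integral>y. h y \<partial>gaussian_measure (L *v x + a) Q1) \<partial>gaussian_measure m Q0)
    = (\<integral>y. h y \<partial>gaussian_measure (L *v m + a) (L ** Q0 ** transpose L + Q1))"
proof -
  have [measurable]: "h \<in> borel_measurable borel"
    using borel_measurable_integrable[OF int] by simp
  have S: "pos_def (L ** Q0 ** transpose L + Q1)" by (intro pos_def_add pos_def_congruence assms)
  note pos = less_imp_le[OF gaussian_density_pos[OF Q0]] less_imp_le[OF gaussian_density_pos[OF Q1]]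
    less_imp_le[OF gaussian_density_pos[OF S]]
  have [measurable]: "(\<lambda>x. \<integral>y. h y \<partial>gaussian_measure (L *v x + a) Q1) \<in> borel_measurable borel"
    by (simp add: integral_gaussian_measure[OF Q1])
  have "(\<integral>x. (\<integral>y. h y \<partial>gaussian_measure (L *v x + a) Q1) \<partial>gaussian_measure m Q0)
    = (\<integral>x. gaussian_density m Q0 x * (\<integral>y. gaussian_density (L *v x + a) Q1 y * h y \<partial>lborel) \<partial>lborel)"
    by (simp add: integral_gaussian_measure Q0 Q1)
  also have "\<dots> = (\<integral>x. (\<integral>y. gaussian_density m Q0 x * gaussian_density (L *v x + a) Q1 y * h y \<partial>lborel) \<partial>lborel)"
    by (simp add: mult.assoc)
  also have "\<dots> = (\<integral>y. (\<integral>x. gaussian_density m Q0 x * gaussian_density (L *v x + a) Q1 y * h y \<partial>lborel) \<partial>lborel)"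
  proof (rule lborel_pair.Fubini_integral_nn)
    have "(\<integral>\<^sup>+x. (\<integral>\<^sup>+y. ennreal \<bar>gaussian_density m Q0 x * gaussian_density (L *v x + a) Q1 y * h y\<bar> \<partial>lborel) \<partial>lborel)
      = (\<integral>\<^sup>+x. (\<integral>\<^sup>+y. ennreal \<bar>h y\<bar> \<partial>gaussian_measure (L *v x + a) Q1) \<partial>gaussian_measure m Q0)"
      by (simp add: nn_integral_gaussian_measure nn_integral_cmult[symmetric] abs_mult pos ennreal_mult mult.assoc)
    also have "\<dots> = (\<integral>\<^sup>+y. ennreal \<bar>h y\<bar> \<partial>gaussian_measure (L *v m + a) (L ** Q0 ** transpose L + Q1))"
      by (rule nn_integral_gaussian_measure_compose) (use assms in auto)
    also have "\<dots> < \<infinity>" using int unfolding integrable_iff_bounded by simp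
    finally show "(\<integral>\<^sup>+x. (\<integral>\<^sup>+y. ennreal \<bar>gaussian_density m Q0 x * gaussian_density (L *v x + a) Q1 y * h y\<bar> \<partial>lborel) \<partial>lborel) < \<infinity>" .
  qed measurable
  also have "\<dots> = (\<integral>y. gaussian_density (L *v m + a) (L ** Q0 ** transpose L + Q1) y * h y \<partial>lborel)"
  proof (rule Bochner_Integration.integral_cong[OF refl])
    fix y
    have "(\<integral>x. gaussian_density m Q0 x * gaussian_density (L *v x + a) Q1 y \<partial>lborel)
      = enn2real (\<integral>\<^sup>+x. ennreal (gaussian_density m Q0 x) * ennreal (gaussian_density (L *v x + a) Q1 y) \<partial>lborel)"
      by (subst integral_eq_nn_integral) (auto simp: pos ennreal_mult)
    also have "\<dots> = gaussian_density (L *v m + a) (L ** Q0 ** transpose L + Q1) y"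
      by (subst nn_integral_gaussian_density_compose[OF Q0 Q1 L]) (simp add: pos)
    finally show "(\<integral>x. gaussian_density m Q0 x * gaussian_density (L *v x + a) Q1 y * h y \<partial>lborel)
      = gaussian_density (L *v m + a) (L ** Q0 ** transpose L + Q1) y * h y" by simp
  qed
  finally show ?thesis by (simp add: integral_gaussian_measure S)
qed

text \<open>Jensen's inequality, by Cauchy-Schwarz against the constant 1. For non-integrable h the
  left side is 0 by convention.\<close>

lemma (in prob_space) square_integral_le_nn_integral_square:
  fixes h :: "'a \<Rightarrow> real"
  assumes [measurable]: "h \<in> borel_measurable M"
  shows "ennreal ((\<integral>x. h x \<partial>M)\<^sup>2) \<le> (\<integral>\<^sup>+x. ennreal ((h x)\<^sup>2) \<partial>M)"
proof -
  have "ennreal \<bar>\<integral>x. h x \<partial>M\<bar> \<le> (\<integral>\<^sup>+x. ennreal \<bar>h x\<bar> \<partial>M)"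
    by (cases "integrable M h")
       (simp_all add: not_integrable_integral_eq integral_norm_bound_ennreal[where f=h, unfolded real_norm_def])
  then have "(ennreal \<bar>\<integral>x. h x \<partial>M\<bar>)\<^sup>2 \<le> (\<integral>\<^sup>+x. ennreal \<bar>h x\<bar> * 1 \<partial>M)\<^sup>2"
    by (intro power_mono) auto
  also have "\<dots> \<le> (\<integral>\<^sup>+x. (ennreal \<bar>h x\<bar>)\<^sup>2 \<partial>M) * (\<integral>\<^sup>+x. 1\<^sup>2 \<partial>M)"
    by (rule Cauchy_Schwarz_nn_integral) auto
  finally show ?thesis by (simp add: ennreal_power emeasure_space_1)
qed

text \<open>The kernel factors through the Mehler kernel with parameter \<open>\<rho>\<close> on the target space; the
  remaining Markov kernel transports the source measure to the target measure and so contracts.\<close>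
theorem gaussian_kernel_contraction:
  fixes L Qs Qt Q :: "real^'n^'n" and \<phi> :: "real^'n \<Rightarrow> real"
  assumes Qs: "pos_def Qs" and Qt: "pos_def Qt" and Q: "Qt = L ** Qs ** transpose L + Q" and L: "det L \<noteq> 0"
    and \<rho>: "0 < \<rho>" "\<rho> < 1" and gap: "pos_def (\<rho>\<^sup>2 *\<^sub>R Qt - L ** Qs ** transpose L)"
    and mt: "mt = L *v ms + a"
    and [measurable]: "\<phi> \<in> borel_measurable borel" and \<phi>2: "integrable (gaussian_measure mt Qt) (\<lambda>x. (\<phi> x)\<^sup>2)"
  defines "P \<equiv> \<lambda>x. \<integral>y. \<phi> y - (\<integral>z. \<phi> z \<partial>gaussian_measure mt Qt) \<partial>gaussian_measure (L *v x + a) Q"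
  shows "integrable (gaussian_measure ms Qs) (\<lambda>x. (P x)\<^sup>2)"
    and "(\<integral>x. (P x)\<^sup>2 \<partial>gaussian_measure ms Qs) \<le> \<rho>\<^sup>2 * (\<integral>x. (\<phi> x)\<^sup>2 \<partial>gaussian_measure mt Qt)"
proof -
  define \<psi> where "\<psi> y = \<phi> y - (\<integral>z. \<phi> z \<partial>gaussian_measure mt Qt)" for y
  have [measurable]: "\<psi> \<in> borel_measurable borel" by (simp add: \<psi>_def[abs_def])
  interpret N: symmetric_markov_family "gaussian_measure mt Qt" "mehler_kernel mt Qt" "CARD('n) * 2 ^ CARD('n)"
    by (rule mehler_kernel_markov[OF Qt])
  have U: "N.prob UNIV = 1" using N.prob_space by simp
  have \<phi>1: "integrable (gaussian_measure mt Qt) \<phi>"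
    by (rule N.square_integrable_imp_integrable) (use \<phi>2 in auto)
  define M where "M = (\<integral>z. \<phi> z \<partial>gaussian_measure mt Qt)"
  have mean: "(\<integral>y. \<psi> y \<partial>gaussian_measure mt Qt) = 0"
    using \<phi>1 by (simp add: \<psi>_def U)
  have sq: "(\<psi> y)\<^sup>2 = (\<phi> y)\<^sup>2 - 2 * M * \<phi> y + M\<^sup>2" for y
    by (simp add: \<psi>_def M_def power2_diff)
  have \<psi>2: "integrable (gaussian_measure mt Qt) (\<lambda>y. (\<psi> y)\<^sup>2)"
    unfolding sq using \<phi>1 \<phi>2 by auto
  have "(\<integral>y. (\<psi> y)\<^sup>2 \<partial>gaussian_measure mt Qt) = (\<integral>y. (\<phi> y)\<^sup>2 \<partial>gaussian_measure mt Qt) - 2 * M * M + M\<^sup>2"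
    unfolding sq using \<phi>1 \<phi>2 by (simp add: U M_def)
  \<comment> \<open>The variance is at most the second moment: centring removes exactly M^2.\<close>
  then have \<psi>\<phi>: "(\<integral>y. (\<psi> y)\<^sup>2 \<partial>gaussian_measure mt Qt) \<le> (\<integral>y. (\<phi> y)\<^sup>2 \<partial>gaussian_measure mt Qt)"
    by (simp add: power2_eq_square)

  define q where "q = 1 - \<rho>\<^sup>2"
  have q: "q > 0" using \<rho> by (simp add: q_def power_less_one_iff abs_square_less_1)
  have qQ: "pos_def (q *\<^sub>R Qt)" by (rule pos_def_mult[OF Qt q])
  \<comment> \<open>\<open>R\<close>, \<open>b\<close> and \<open>W\<close> are chosen so that x ->
    N(R x + b, W) carries N(ms, Qs) to N(mt, Qt). The division by \<rho> compensates the Mehler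
    step, which contracts by \<rho>; \<open>gap\<close> is exactly positivity of
    \<open>W\<close>.\<close>
  define R where "R = (1 / \<rho>) *\<^sub>R L"
  define b where "b = mt - R *v ms"
  define W where "W = (1 / \<rho>\<^sup>2) *\<^sub>R (\<rho>\<^sup>2 *\<^sub>R Qt - L ** Qs ** transpose L)"
  have W: "pos_def W" unfolding W_def by (rule pos_def_mult[OF gap]) (use \<rho> in simp)
  have detR: "det R \<noteq> 0" using L \<rho> by (simp add: R_def det_scaleR)
  have RQ: "R ** Qs ** transpose R = (1 / \<rho>\<^sup>2) *\<^sub>R (L ** Qs ** transpose L)"
    by (simp add: R_def transpose_scalar scalar_matrix_assoc[symmetric] matrix_scalar_ac power2_eq_square)
  have RW: "R ** Qs ** transpose R + W = Qt"
    using \<rho> by (simp add: RQ W_def scaleR_diff_right)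
  \<comment> \<open>The factor \<rho> is written as a matrix so that the Mehler step fits the affine
    kernels of the composition lemma.\<close>
  define I\<rho> where "I\<rho> = (mat \<rho> :: real^'n^'n)"
  have I\<rho>: "I\<rho> = \<rho> *\<^sub>R mat 1" by (simp add: I\<rho>_def mat_def vec_eq_iff)
  have det\<rho>: "det I\<rho> \<noteq> 0" using \<rho> by (simp add: I\<rho> det_scaleR)
  have I\<rho>v: "I\<rho> *v x = \<rho> *\<^sub>R x" for x by (simp add: I\<rho> scaleR_matrix_vector_assoc[symmetric])
  \<comment> \<open>The covariance after both steps is \<rho>^2 W + (1 - \<rho>^2) Qt = Qt - L Qs
    L^T = Q.\<close>
  have cov: "I\<rho> ** W ** transpose I\<rho> + q *\<^sub>R Qt = Q"
  proof -
    have "I\<rho> ** W ** transpose I\<rho> = \<rho>\<^sup>2 *\<^sub>R W"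
      by (simp add: I\<rho> transpose_scalar scalar_matrix_assoc[symmetric] matrix_scalar_ac power2_eq_square)
    also have "\<dots> = \<rho>\<^sup>2 *\<^sub>R Qt - L ** Qs ** transpose L" using \<rho> by (simp add: W_def)
    finally show ?thesis by (simp add: q_def scaleR_diff_left Q)
  qed
  have mean_x: "I\<rho> *v (R *v x + b) + (1 - \<rho>) *\<^sub>R mt = L *v x + a" for x
  proof -
    have "\<rho> *\<^sub>R (R *v y) = L *v y" for y
      using \<rho> by (simp add: R_def scaleR_matrix_vector_assoc)
    then show ?thesis
      by (simp add: I\<rho>v b_def algebra_simps) (simp add: mt)
  qed

  have T: "(\<integral>z. \<psi> z \<partial>gaussian_measure (I\<rho> *v y + (1 - \<rho>) *\<^sub>R mt) (q *\<^sub>R Qt)) = N.T \<rho> \<psi> y" for y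
  proof -
    have [measurable]: "mehler_kernel mt Qt \<rho> y \<in> borel_measurable borel"
      unfolding mehler_kernel_def[abs_def] by measurable
    show ?thesis
      unfolding N.T_def I\<rho>v integral_gaussian_measure[OF qQ \<open>\<psi> \<in> borel_measurable borel\<close>]
      by (subst integral_gaussian_measure[OF Qt])
         (simp_all add: q_def gaussian_density_mehler_kernel[OF Qt \<rho>] mult.assoc)
  qed
  have T_meas [measurable]: "N.T \<rho> \<psi> \<in> borel_measurable borel"
    using N.T_measurable[OF \<rho>, of \<psi>] by simp
  \<comment> \<open>Positivity of the transition covariance is read off from the two-step
    decomposition.\<close>
  have Q': "pos_def Q"
    unfolding cov[symmetric] by (intro pos_def_add pos_def_congruence W det\<rho> qQ)
  have P_meas [measurable]: "P \<in> borel_measurable borel"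
    unfolding P_def \<psi>_def[symmetric] by (simp add: integral_gaussian_measure[OF Q'])
  \<comment> \<open>Where \<psi> is not integrable for the transition kernel the Bochner integral is
    0, so the bound holds at every x and no null set has to be tracked.\<close>
  have le: "ennreal ((P x)\<^sup>2) \<le> (\<integral>\<^sup>+y. ennreal ((N.T \<rho> \<psi> y)\<^sup>2) \<partial>gaussian_measure (R *v x + b) W)" for x
  proof (cases "integrable (gaussian_measure (L *v x + a) Q) \<psi>")
    case True
    interpret R: prob_space "gaussian_measure (R *v x + b) W" by (rule prob_space_gaussian_measure[OF W])
    have "P x = (\<integral>y. N.T \<rho> \<psi> y \<partial>gaussian_measure (R *v x + b) W)"
      using integral_gaussian_measure_compose[OF W qQ det\<rho>, of "R *v x + b" "(1 - \<rho>) *\<^sub>R mt" \<psi>] True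
      unfolding cov mean_x T by (simp add: P_def \<psi>_def[abs_def])
    then show ?thesis using R.square_integral_le_nn_integral_square[of "N.T \<rho> \<psi>"] by simp
  next
    case False
    then have "P x = 0" unfolding P_def \<psi>_def[symmetric] by (rule not_integrable_integral_eq)
    then show ?thesis by simp
  qed
  have "(\<integral>\<^sup>+x. ennreal ((P x)\<^sup>2) \<partial>gaussian_measure ms Qs)
    \<le> (\<integral>\<^sup>+x. (\<integral>\<^sup>+y. ennreal ((N.T \<rho> \<psi> y)\<^sup>2) \<partial>gaussian_measure (R *v x + b) W) \<partial>gaussian_measure ms Qs)"
    by (intro nn_integral_mono le)
  also have "\<dots> = (\<integral>\<^sup>+y. ennreal ((N.T \<rho> \<psi> y)\<^sup>2) \<partial>gaussian_measure mt Qt)"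
    using nn_integral_gaussian_measure_compose[OF Qs W detR, of "\<lambda>y. ennreal ((N.T \<rho> \<psi> y)\<^sup>2)" ms b]
    unfolding RW by (simp add: b_def)
  also have "\<dots> = ennreal (\<integral>y. (N.T \<rho> \<psi> y)\<^sup>2 \<partial>gaussian_measure mt Qt)"
    by (rule nn_integral_eq_integral[OF N.T_square_integrable[OF \<rho> _ \<psi>2]]) auto
  also have "\<dots> \<le> ennreal (\<rho>\<^sup>2 * (\<integral>y. (\<psi> y)\<^sup>2 \<partial>gaussian_measure mt Qt))"
    by (intro ennreal_leI N.spectral_gap[OF \<rho> _ \<psi>2 mean]) simp
  also have "\<dots> \<le> ennreal (\<rho>\<^sup>2 * (\<integral>y. (\<phi> y)\<^sup>2 \<partial>gaussian_measure mt Qt))"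
    by (intro ennreal_leI mult_left_mono \<psi>\<phi>) simp
  finally have fin: "(\<integral>\<^sup>+x. ennreal ((P x)\<^sup>2) \<partial>gaussian_measure ms Qs)
    \<le> ennreal (\<rho>\<^sup>2 * (\<integral>y. (\<phi> y)\<^sup>2 \<partial>gaussian_measure mt Qt))" .
  show int: "integrable (gaussian_measure ms Qs) (\<lambda>x. (P x)\<^sup>2)"
    by (rule integrableI_nonneg) (use fin in \<open>auto intro: le_less_trans\<close>)
  show "(\<integral>x. (P x)\<^sup>2 \<partial>gaussian_measure ms Qs) \<le> \<rho>\<^sup>2 * (\<integral>x. (\<phi> x)\<^sup>2 \<partial>gaussian_measure mt Qt)"
    using fin by (subst (asm) nn_integral_eq_integral[OF int]) (auto simp: ennreal_le_iff)
qed

section \<open>Stable linear systems\<close>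

lemma has_integral_exp_atMost:
  fixes a c :: real
  assumes "a > 0"
  shows "((\<lambda>x. exp (a * x)) has_integral exp (a * c) / a) {..c}"
proof -
  have "((\<lambda>x::real. exp (- a * x)) has_integral exp (- a * (- c)) / a) {-c..}"
    by (rule has_integral_exp_minus_to_infinity[OF assms])
  then have 1: "(\<lambda>x::real. exp (- a * x)) absolutely_integrable_on {-c..} \<and> integral {-c..} (\<lambda>x::real. exp (- a * x)) = exp (a * c) / a"
    by (auto simp: integral_unique intro!: nonnegative_absolutely_integrable_1 has_integral_integrable)
  have "(\<lambda>x. exp (a * x)) absolutely_integrable_on {..c} \<and> integral {..c} (\<lambda>x. exp (a * x)) = exp (a * c) / a"
    using has_absolute_integral_reflect_real[of "{..c}" "{-c..}" "\<lambda>x. exp (- a * x)" "exp (a * c) / a"] 1 by auto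
  then show ?thesis
    using absolutely_integrable_on_def has_integral_iff by blast
qed

lemma exp_decay_integrable:
  fixes b K t :: real
  assumes "b > 0"
  shows "(\<lambda>r. K * exp (- b * (t - r))) integrable_on {..t}"
    and "integral {..t} (\<lambda>r. K * exp (- b * (t - r))) = K / b"
proof -
  have "((\<lambda>r. K * exp (- b * t) * exp (b * r)) has_integral (K * exp (- b * t) * (exp (b * t) / b))) {..t}"
    by (rule has_integral_mult_right[OF has_integral_exp_atMost[OF assms]])
  moreover have "(\<lambda>r. K * exp (- b * t) * exp (b * r)) = (\<lambda>r. K * exp (- b * (t - r)))"
    by (simp add: mult.assoc algebra_simps flip: exp_add)
  moreover have "K * exp (- b * t) * (exp (b * t) / b) = K / b"
    by (simp flip: exp_add)
  ultimately have "((\<lambda>r. K * exp (- b * (t - r))) has_integral K / b) {..t}" by (simp only:)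
  then show "(\<lambda>r. K * exp (- b * (t - r))) integrable_on {..t}"
    "integral {..t} (\<lambda>r. K * exp (- b * (t - r))) = K / b"
    by (rule has_integral_integrable, rule integral_unique)
qed

section \<open>Operator bounds for matrices and their transposes\<close>

lemma norm_matrix_vector_le_opnorm: "norm (A *v x) \<le> opnorm A * norm x"
  unfolding opnorm_def by (rule onorm[OF matrix_vector_mul_bounded_linear])

lemma opnorm_le: "(\<And>x. norm (A *v x) \<le> c * norm x) \<Longrightarrow> opnorm A \<le> c"
  unfolding opnorm_def by (rule onorm_le)

lemma opnorm_le_norm: "opnorm A \<le> real CARD('n) * real CARD('n) * norm A" for A :: "real^'n^'n"
  unfolding opnorm_def
proof (rule onorm_le_matrix_component)
  show "\<bar>A $ i $ j\<bar> \<le> norm A" for i j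
    by (metis component_le_norm_cart Finite_Cartesian_Product.norm_nth_le order_trans real_norm_def)
qed

lemma bounded_range_opnorm:
  fixes A :: "'a \<Rightarrow> real^'n^'n"
  assumes "bounded (range A)"
  obtains a where "\<And>t. opnorm (A t) \<le> a"
proof -
  obtain b where b: "\<And>t. norm (A t) \<le> b" using assms unfolding bounded_iff by auto
  have "opnorm (A t) \<le> real CARD('n) * real CARD('n) * b" for t
    using opnorm_le_norm[of "A t"] b[of t] by (smt (verit) mult_left_mono of_nat_0_le_iff mult_nonneg_nonneg)
  then show ?thesis by (rule that)
qed

text \<open>The norm on matrices is the Euclidean norm of the entries, while the estimates are for
  the operator norm; the crude dimensional factor is harmless since the result only feeds an
  integrability bound.\<close>

lemma norm_le_of_matrix_vector_le:
  fixes A :: "real^'n^'n"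
  assumes "\<And>x. norm (A *v x) \<le> c * norm x"
  shows "norm A \<le> real CARD('n) * real CARD('n) * c"
proof -
  have e: "\<bar>A $ i $ j\<bar> \<le> c" for i j
    using matrix_component_le_onorm[of A i j] opnorm_le[of A c] assms by (simp add: opnorm_def)
  have "norm A \<le> (\<Sum>i\<in>UNIV. norm (A $ i))" by (simp add: norm_vec_def L2_set_le_sum)
  also have "\<dots> \<le> (\<Sum>i\<in>(UNIV::'n set). \<Sum>j\<in>(UNIV::'n set). \<bar>A $ i $ j\<bar>)"
    by (intro sum_mono norm_le_l1_cart)
  also have "\<dots> \<le> (\<Sum>i\<in>(UNIV::'n set). \<Sum>j\<in>(UNIV::'n set). c)"
    by (intro sum_mono e)
  finally show ?thesis by simp
qed

lemma norm_transpose_le: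
  fixes A :: "real^'n^'n"
  assumes A: "\<And>x. norm (A *v x) \<le> c * norm x" and c: "0 \<le> c"
  shows "norm (transpose A *v y) \<le> c * norm y"
proof (cases "transpose A *v y = 0")
  case True
  then show ?thesis using c by simp
next
  case False
  have "norm (transpose A *v y) * norm (transpose A *v y) = (transpose A *v y) \<bullet> (transpose A *v y)"
    by (simp add: dot_square_norm power2_eq_square)
  also have "\<dots> = y \<bullet> (A *v (transpose A *v y))" by (simp add: dot_lmul_matrix)
  also have "\<dots> \<le> norm y * norm (A *v (transpose A *v y))" by (rule norm_cauchy_schwarz)
  also have "\<dots> \<le> norm y * (c * norm (transpose A *v y))" by (intro mult_left_mono A) simp
  finally show ?thesis using False by (simp add: mult_ac)
qed

text \<open>A square matrix bounded below is invertible, so y = A x with |x| <= |y| / \<mu>, and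
  |y|^2 = <A^T y, x>. This moves the lower bound from B to B^T, which is what the quadratic form of
  the covariance sees.\<close>

lemma norm_transpose_ge:
  fixes A :: "real^'n^'n"
  assumes \<mu>: "\<mu> > 0" and A: "\<And>x. norm (A *v x) \<ge> \<mu> * norm x"
  shows "norm (transpose A *v y) \<ge> \<mu> * norm y"
proof (cases "y = 0")
  case False
  have "x = 0" if "A *v x = 0" for x
    using A[of x] that \<mu> by (simp add: mult_le_0_iff)
  then have "invertible A" by (meson invertible_left_inverse matrix_left_invertible_ker)
  then have "y = A *v (matrix_inv A *v y)" by (simp add: matrix_vector_mul_assoc matrix_inv_mult)
  then obtain x where x: "y = A *v x" by blast
  have "norm y * norm y = y \<bullet> (A *v x)" by (simp add: x dot_square_norm power2_eq_square)
  also have "\<dots> = (transpose A *v y) \<bullet> x" by (simp add: dot_lmul_matrix)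
  also have "\<dots> \<le> norm (transpose A *v y) * norm x" by (rule norm_cauchy_schwarz)
  also have "\<dots> \<le> norm (transpose A *v y) * (norm y / \<mu>)"
    using A[of x] \<mu> by (intro mult_left_mono) (auto simp: x field_simps)
  finally show ?thesis using False \<mu> by (simp add: field_simps)
qed simp

section \<open>Calculus of matrix-valued functions and linear equations\<close>

lemma bounded_bilinear_matrix_mult:
  "bounded_bilinear ((**) :: real^'n^'m \<Rightarrow> real^'p^'n \<Rightarrow> real^'p^'m)"
  unfolding bilinear_conv_bounded_bilinear[symmetric] bilinear_def
  by (auto intro!: linearI simp: matrix_add_ldistrib matrix_add_rdistrib matrix_scalar_ac scalar_matrix_assoc)

lemma bounded_bilinear_matrix_vector_mult:
  "bounded_bilinear ((*v) :: real^'n^'m \<Rightarrow> real^'n \<Rightarrow> real^'m)"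
  unfolding bilinear_conv_bounded_bilinear[symmetric] bilinear_def
  by (auto intro!: linearI simp: matrix_vector_right_distrib matrix_vector_mult_add_rdistrib
      matrix_vector_mult_scaleR scaleR_matrix_vector_assoc)

lemma bounded_linear_transpose: "bounded_linear (transpose :: real^'n^'m \<Rightarrow> real^'m^'n)"
  unfolding linear_conv_bounded_linear[symmetric]
  by (auto intro!: linearI simp: transpose_def vec_eq_iff)

lemma bounded_linear_quadratic_form: "bounded_linear (\<lambda>X :: real^'n^'n. x \<bullet> (X *v x))"
  by (rule bounded_linear_compose[OF bounded_linear_inner_right
        bounded_bilinear.bounded_linear_left[OF bounded_bilinear_matrix_vector_mult]])

lemmas continuous_on_matrix_mult = bounded_bilinear.continuous_on[OF bounded_bilinear_matrix_mult]
lemmas continuous_on_matrix_vector_mult = bounded_bilinear.continuous_on[OF bounded_bilinear_matrix_vector_mult]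
lemmas continuous_on_transpose = bounded_linear.continuous_on[OF bounded_linear_transpose]

text \<open>Gronwall in both time directions: |w|^2 exp(-2 a \<tau>) is nonincreasing and |w|^2
  exp(2 a \<tau>) nondecreasing, so w vanishes after and before \<open>t0\<close>. The backward half
  lets the cocycle identity hold for times in any order.\<close>

lemma linear_ode_zero_unique:
  fixes w :: "real \<Rightarrow> real^'n"
  assumes w: "\<And>t. (w has_vector_derivative A t *v w t) (at t)"
    and A: "\<And>t x. norm (A t *v x) \<le> a * norm x" and w0: "w t0 = 0"
  shows "w t = 0"
proof -
  define h where "h b \<tau> = (w \<tau> \<bullet> w \<tau>) * exp (b * \<tau>)" for b \<tau>
  have h: "(h b has_real_derivative (2 * (w \<tau> \<bullet> (A \<tau> *v w \<tau>)) + b * (w \<tau> \<bullet> w \<tau>)) * exp (b * \<tau>)) (at \<tau>)" for b \<tau>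
  proof -
    have "((\<lambda>\<tau>. w \<tau> \<bullet> w \<tau>) has_vector_derivative (w \<tau> \<bullet> (A \<tau> *v w \<tau>) + (A \<tau> *v w \<tau>) \<bullet> w \<tau>)) (at \<tau>)"
      by (rule bounded_bilinear.has_vector_derivative[OF bounded_bilinear_inner w w])
    then have "((\<lambda>\<tau>. w \<tau> \<bullet> w \<tau>) has_real_derivative (2 * (w \<tau> \<bullet> (A \<tau> *v w \<tau>)))) (at \<tau>)"
      by (simp add: has_real_derivative_iff_has_vector_derivative inner_commute)
    then show ?thesis
      unfolding h_def by (auto intro!: derivative_eq_intros simp: algebra_simps)
  qed
  have bd: "\<bar>w \<tau> \<bullet> (A \<tau> *v w \<tau>)\<bar> \<le> a * (w \<tau> \<bullet> w \<tau>)" for \<tau>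
  proof -
    have "\<bar>w \<tau> \<bullet> (A \<tau> *v w \<tau>)\<bar> \<le> norm (w \<tau>) * norm (A \<tau> *v w \<tau>)" by (rule Cauchy_Schwarz_ineq2)
    also have "\<dots> \<le> norm (w \<tau>) * (a * norm (w \<tau>))" by (intro mult_left_mono A) simp
    finally show ?thesis by (simp add: dot_square_norm power2_eq_square mult_ac)
  qed
  have "w t \<bullet> w t \<le> 0"
  proof (cases "t0 \<le> t")
    case True
    have "h (- 2 * a) t \<le> h (- 2 * a) t0"
    proof (rule DERIV_nonpos_imp_nonincreasing[OF True, where f = "h (- 2 * a)"])
      fix \<tau>
      have "(2 * (w \<tau> \<bullet> (A \<tau> *v w \<tau>)) + (- 2 * a) * (w \<tau> \<bullet> w \<tau>)) * exp ((- 2 * a) * \<tau>) \<le> 0"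
        using bd[of \<tau>] by (intro mult_nonpos_nonneg) (auto simp: abs_le_iff)
      then show "\<exists>y. (h (- 2 * a) has_real_derivative y) (at \<tau>) \<and> y \<le> 0" using h by blast
    qed
    then show ?thesis using w0 by (simp add: h_def mult_le_0_iff)
  next
    case False
    have "h (2 * a) t \<le> h (2 * a) t0"
    proof (rule DERIV_nonneg_imp_nondecreasing[where f = "h (2 * a)"])
      fix \<tau>
      have "0 \<le> (2 * (w \<tau> \<bullet> (A \<tau> *v w \<tau>)) + (2 * a) * (w \<tau> \<bullet> w \<tau>)) * exp ((2 * a) * \<tau>)"
        using bd[of \<tau>] by (intro mult_nonneg_nonneg) (auto simp: abs_le_iff)
      then show "\<exists>y. (h (2 * a) has_real_derivative y) (at \<tau>) \<and> 0 \<le> y" using h by blast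
    qed (use False in simp)
    then show ?thesis using w0 by (simp add: h_def mult_le_0_iff)
  qed
  then show ?thesis by (metis antisym inner_eq_zero_iff inner_ge_zero)
qed

lemma has_integral_atMost_split:
  fixes f :: "real \<Rightarrow> 'a::banach"
  assumes "s \<le> t" "(f has_integral i) {..s}" "(f has_integral j) {s..t}"
  shows "(f has_integral (i + j)) {..t}"
proof -
  have "{..s} \<inter> {s..t} = {s}" "{..s} \<union> {s..t} = {..t}" using assms(1) by auto
  then show ?thesis using has_integral_Un[OF assms(2,3)] by simp
qed

text \<open>Near r, cutting the half-line at r - 1 leaves a constant plus an integral over a compact
  interval, where the fundamental theorem applies.\<close>

lemma integral_atMost_has_real_derivative:
  fixes k :: "real \<Rightarrow> real"
  assumes k: "continuous_on UNIV k" and int: "\<And>b. k integrable_on {..b}"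
  shows "((\<lambda>r. integral {..r} k) has_real_derivative k r) (at r)"
proof -
  have eq: "integral {..x} k = integral {..r - 1} k + integral {r - 1..x} k" if "x \<in> {r - 1<..<r + 1}" for x
  proof (rule integral_unique[OF has_integral_atMost_split])
    show "(k has_integral integral {r - 1..x} k) {r - 1..x}"
      by (intro integrable_integral integrable_continuous_interval continuous_on_subset[OF k]) simp
  qed (use that int in auto)
  have "((\<lambda>x. integral {r - 1..x} k) has_real_derivative k r) (at r within {r - 1..r + 1})"
    by (rule integral_has_real_derivative) (auto intro: continuous_on_subset[OF k])
  then have "((\<lambda>x. integral {r - 1..x} k) has_real_derivative k r) (at r)"
    by (simp add: at_within_interior[of r "{r - 1..r + 1}"] interior_atLeastAtMost_real)
  then have "((\<lambda>x. integral {..r - 1} k + integral {r - 1..x} k) has_real_derivative k r) (at r)"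
    by (auto intro!: derivative_eq_intros)
  then show ?thesis
    by (rule has_field_derivative_transform_within_open[OF _ open_greaterThanLessThan[of "r - 1" "r + 1"]]) (auto simp: eq)
qed

text \<open>One rate \<omega> is fixed together with its constant M = M(\<omega>), and suprema are
  replaced by the pointwise bounds they yield; the infimum over \<omega> is taken only at the
  end.\<close>

locale stable_linear_system =
  fixes A B :: "real \<Rightarrow> real^'n^'n" and f :: "real \<Rightarrow> real^'n" and U :: "real \<Rightarrow> real \<Rightarrow> real^'n^'n"
    and a M \<omega> C \<mu> F :: real
  assumes A_le: "norm (A t *v x) \<le> a * norm x"
    and B_cont: "continuous_on UNIV B" and f_cont: "continuous_on UNIV f"
    and B_le: "norm (B t *v x) \<le> C * norm x" and B_ge: "norm (B t *v x) \<ge> \<mu> * norm x"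
    and f_le: "norm (f t) \<le> F" and \<mu>_pos: "\<mu> > 0" and C_pos: "C > 0" and M_pos: "M > 0" and \<omega>_neg: "\<omega> < 0"
    and evol: "evolution_operator A U"
    and U_le: "s \<le> t \<Longrightarrow> norm (U t s *v x) \<le> M * exp (\<omega> * (t - s)) * norm x"
begin

lemma U_refl [simp]: "U s s = mat 1"
  using evol by (simp add: evolution_operator_def)

lemma U_vector_derivative: "((\<lambda>\<tau>. U \<tau> s *v x) has_vector_derivative A t *v (U t s *v x)) (at t)"
proof -
  have "((\<lambda>\<tau>. U \<tau> s) has_vector_derivative A t ** U t s) (at t)"
    using evol by (simp add: evolution_operator_def)
  from bounded_linear.has_vector_derivative[OF bounded_bilinear.bounded_linear_left[OF bounded_bilinear_matrix_vector_mult] this, of x]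
  show ?thesis by (simp add: matrix_vector_mul_assoc)
qed

text \<open>Both sides solve the same equation in t and agree at t = r. The times may come in any
  order, so U(s,t) inverts U(t,s).\<close>

lemma U_cocycle: "U t s = U t r ** U r s"
proof -
  have "U t s *v x - U t r *v (U r s *v x) = 0" for x
  proof (rule linear_ode_zero_unique[where A = A and a = a and w = "\<lambda>t. U t s *v x - U t r *v (U r s *v x)"])
    show "((\<lambda>t. U t s *v x - U t r *v (U r s *v x)) has_vector_derivative
      A t *v (U t s *v x - U t r *v (U r s *v x))) (at t)" for t
      unfolding matrix_vector_mult_diff_distrib by (intro has_vector_derivative_diff U_vector_derivative)
    show "U r s *v x - U r r *v (U r s *v x) = 0" by simp
  qed (rule A_le)
  then show ?thesis by (simp add: matrix_eq matrix_vector_mul_assoc)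
qed

lemma det_U: "det (U t s) \<noteq> 0"
  using U_cocycle[of t t s] by (metis U_refl det_I det_mul mult_zero_left zero_neq_one)

text \<open>The definition gives regularity in the first argument only. By the cocycle identity a
  change of the second argument becomes a change of the first, followed by a bounded
  operator.\<close>

lemma continuous_on_U: "continuous_on UNIV (U t)"
proof -
  have "isCont (\<lambda>r. U t r *v x) r0" for x r0
  proof -
    define y where "y = U 0 r0 *v x"
    \<comment> \<open>The end time r0 + 1 lies above all r near r0, so the operator in front has
      norm at most M; an arbitrary end time t is reached afterwards by one more cocycle
      step.\<close>
    have diff: "U (r0 + 1) r *v x - U (r0 + 1) r0 *v x = U (r0 + 1) r *v (U r0 0 *v y - U r 0 *v y)" for r
    proof -
      have "U (r0 + 1) r *v (U r 0 *v y) = (U (r0 + 1) r ** U r 0 ** U 0 r0) *v x"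
        by (simp add: y_def matrix_vector_mul_assoc matrix_mul_assoc)
      also have "\<dots> = U (r0 + 1) r0 *v x" by (simp flip: U_cocycle)
      finally have 1: "U (r0 + 1) r *v (U r 0 *v y) = U (r0 + 1) r0 *v x" .
      have "U r0 0 *v y = (U r0 0 ** U 0 r0) *v x" by (simp add: y_def matrix_vector_mul_assoc)
      also have "\<dots> = x" by (simp flip: U_cocycle)
      finally show ?thesis by (simp add: matrix_vector_mult_diff_distrib 1)
    qed
    have "((\<lambda>r. M * norm (U r0 0 *v y - U r 0 *v y)) \<longlongrightarrow> M * norm (U r0 0 *v y - U r0 0 *v y)) (at r0)"
      using has_vector_derivative_continuous[OF U_vector_derivative[of 0 y r0]]
      by (intro tendsto_intros) (simp add: continuous_within)
    then have "((\<lambda>r. M * norm (U r0 0 *v y - U r 0 *v y)) \<longlongrightarrow> 0) (at r0)" by simp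
    moreover have "\<forall>\<^sub>F r in at r0. norm (U (r0 + 1) r *v x - U (r0 + 1) r0 *v x) \<le> M * norm (U r0 0 *v y - U r 0 *v y)"
    proof -
      have "\<forall>\<^sub>F r in at r0. r < r0 + 1" by (rule order_tendstoD[OF tendsto_ident_at]) simp
      then show ?thesis
      proof eventually_elim
        case (elim r)
        have "norm (U (r0 + 1) r *v x - U (r0 + 1) r0 *v x)
          \<le> M * exp (\<omega> * (r0 + 1 - r)) * norm (U r0 0 *v y - U r 0 *v y)"
          unfolding diff by (rule U_le) (use elim in simp)
        also have "\<dots> \<le> M * 1 * norm (U r0 0 *v y - U r 0 *v y)"
          using elim M_pos \<omega>_neg by (intro mult_right_mono mult_left_mono) (auto simp: mult_le_0_iff)
        finally show ?case by simp
      qed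
    qed
    ultimately have "((\<lambda>r. U (r0 + 1) r *v x - U (r0 + 1) r0 *v x) \<longlongrightarrow> 0) (at r0)"
      by (rule Lim_null_comparison[rotated])
    then have "((\<lambda>r. U (r0 + 1) r *v x) \<longlongrightarrow> U (r0 + 1) r0 *v x) (at r0)"
      by (simp add: LIM_zero_iff)
    then have "((\<lambda>r. U t (r0 + 1) *v (U (r0 + 1) r *v x)) \<longlongrightarrow> U t (r0 + 1) *v (U (r0 + 1) r0 *v x)) (at r0)"
      by (rule bounded_linear.tendsto[OF matrix_vector_mul_bounded_linear])
    then show ?thesis
      unfolding matrix_vector_mul_assoc U_cocycle[symmetric] isCont_def .
  qed
  then have c: "continuous_on UNIV (\<lambda>r. U t r *v x)" for x
    by (simp add: continuous_at_imp_continuous_on)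
  have "U t r = (\<chi> i j. (U t r *v axis j 1) $ i)" for r
    by (simp add: vec_eq_iff matrix_vector_mult_basis column_def)
  moreover have "continuous_on UNIV (\<lambda>r. \<chi> i j. (U t r *v axis j 1) $ i)"
    by (intro continuous_on_vec_lambda continuous_on_component c)
  ultimately show ?thesis by simp
qed

definition cov_rate :: "real \<Rightarrow> real \<Rightarrow> real^'n^'n" where
  "cov_rate t r = U t r ** B r ** transpose (B r) ** transpose (U t r)"

definition drift_rate :: "real \<Rightarrow> real \<Rightarrow> real^'n" where
  "drift_rate t r = U t r *v f r"

text \<open>Changing the end time is a congruence by U(t,s), so integrals of
  \<open>cov_rate t\<close> up to s reduce to \<open>stat_cov s\<close>.\<close>

lemma cov_rate_cocycle: "cov_rate t r = U t s ** cov_rate s r ** transpose (U t s)"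
  unfolding cov_rate_def U_cocycle[of t r s] by (simp add: matrix_transpose_mul matrix_mul_assoc)

lemma drift_rate_cocycle: "drift_rate t r = U t s *v drift_rate s r"
  unfolding drift_rate_def U_cocycle[of t r s] by (simp add: matrix_vector_mul_assoc)

lemma cov_rate_quadratic: "x \<bullet> (cov_rate t r *v x) = (norm (transpose (B r) *v (transpose (U t r) *v x)))\<^sup>2"
proof -
  have "cov_rate t r = U t r ** (B r ** mat 1 ** transpose (B r)) ** transpose (U t r)"
    by (simp add: cov_rate_def matrix_mul_assoc)
  then show ?thesis unfolding power2_norm_eq_inner by (simp only: dot_congruence matrix_vector_mul_lid)
qed

lemma cov_rate_symmetric: "transpose (cov_rate t r) = cov_rate t r"
  by (simp add: cov_rate_def matrix_transpose_mul matrix_mul_assoc)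

lemma continuous_on_cov_rate: "continuous_on S (cov_rate t)"
  unfolding cov_rate_def[abs_def]
  by (intro continuous_on_matrix_mult continuous_on_transpose continuous_on_subset[OF continuous_on_U]
      continuous_on_subset[OF B_cont]) auto

lemma continuous_on_drift_rate: "continuous_on S (drift_rate t)"
  unfolding drift_rate_def[abs_def]
  by (intro continuous_on_matrix_vector_mult continuous_on_subset[OF continuous_on_U]
      continuous_on_subset[OF f_cont]) auto

lemma transpose_U_le: "r \<le> t \<Longrightarrow> norm (transpose (U t r) *v x) \<le> M * exp (\<omega> * (t - r)) * norm x"
  by (rule norm_transpose_le[OF U_le]) (use M_pos in auto)

lemma transpose_B_le: "norm (transpose (B r) *v x) \<le> C * norm x"
  by (rule norm_transpose_le[OF B_le]) (use C_pos in auto)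

lemma cov_rate_le:
  assumes "r \<le> t"
  shows "norm (cov_rate t r *v x) \<le> M\<^sup>2 * C\<^sup>2 * exp (- (- 2 * \<omega>) * (t - r)) * norm x"
proof -
  let ?e = "M * exp (\<omega> * (t - r))"
  have e: "0 \<le> ?e" using M_pos by simp
  have "norm (cov_rate t r *v x) = norm (U t r *v (B r *v (transpose (B r) *v (transpose (U t r) *v x))))"
    by (simp only: cov_rate_def matrix_vector_mul_assoc matrix_mul_assoc)
  also have "\<dots> \<le> ?e * norm (B r *v (transpose (B r) *v (transpose (U t r) *v x)))" by (rule U_le[OF assms])
  also have "\<dots> \<le> ?e * (C * norm (transpose (B r) *v (transpose (U t r) *v x)))" by (intro mult_left_mono B_le e)
  also have "\<dots> \<le> ?e * (C * (C * norm (transpose (U t r) *v x)))"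
    using C_pos by (intro mult_left_mono transpose_B_le e) auto
  also have "\<dots> \<le> ?e * (C * (C * (?e * norm x)))"
    using C_pos by (intro mult_left_mono transpose_U_le assms e) auto
  also have "\<dots> = M\<^sup>2 * C\<^sup>2 * (exp (\<omega> * (t - r)))\<^sup>2 * norm x" by (simp add: power2_eq_square)
  also have "(exp (\<omega> * (t - r)))\<^sup>2 = exp (- (- 2 * \<omega>) * (t - r))" by (simp flip: exp_double add: mult.assoc)
  finally show ?thesis .
qed

text \<open>The decay bound needs r <= t, but b may lie beyond t. It is therefore applied with end
  time b, and a congruence by U(t,b) transfers the result to t. This freedom lets the energy
  integral be differentiated at every r.\<close>

lemma cov_rate_integrable: "cov_rate t integrable_on {..b}"
proof -
  have "cov_rate b absolutely_integrable_on {..b}"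
  proof (rule measurable_bounded_by_integrable_imp_absolutely_integrable)
    show "cov_rate b \<in> borel_measurable (lebesgue_on {..b})"
      by (intro continuous_imp_measurable_on_sets_lebesgue continuous_on_cov_rate) auto
    let ?n = "real CARD('n) * real CARD('n)"
    show "(\<lambda>r. ?n * (M\<^sup>2 * C\<^sup>2) * exp (- (- 2 * \<omega>) * (b - r))) integrable_on {..b}"
      by (rule exp_decay_integrable) (use \<omega>_neg in simp)
    show "norm (cov_rate b r) \<le> ?n * (M\<^sup>2 * C\<^sup>2) * exp (- (- 2 * \<omega>) * (b - r))" if "r \<in> {..b}" for r
      using norm_le_of_matrix_vector_le[OF cov_rate_le[of r b]] that by (simp add: mult.assoc)
  qed auto
  then have "cov_rate b integrable_on {..b}" by (simp add: absolutely_integrable_on_def)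
  moreover have "bounded_linear (\<lambda>X. U t b ** X ** transpose (U t b))"
    using bounded_linear_compose[OF bounded_bilinear.bounded_linear_left[OF bounded_bilinear_matrix_mult]
        bounded_bilinear.bounded_linear_right[OF bounded_bilinear_matrix_mult]] .
  ultimately have "((\<lambda>X. U t b ** X ** transpose (U t b)) \<circ> cov_rate b) integrable_on {..b}"
    by (rule integrable_linear)
  then show ?thesis by (simp add: o_def cov_rate_cocycle[of t _ b, symmetric])
qed

lemma drift_rate_integrable: "drift_rate t integrable_on {..t}"
proof -
  have "drift_rate t absolutely_integrable_on {..t}"
  proof (rule measurable_bounded_by_integrable_imp_absolutely_integrable)
    show "drift_rate t \<in> borel_measurable (lebesgue_on {..t})"
      by (intro continuous_imp_measurable_on_sets_lebesgue continuous_on_drift_rate) auto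
    show "(\<lambda>r. M * F * exp (- (- \<omega>) * (t - r))) integrable_on {..t}"
      by (rule exp_decay_integrable) (use \<omega>_neg in simp)
    show "norm (drift_rate t r) \<le> M * F * exp (- (- \<omega>) * (t - r))" if "r \<in> {..t}" for r
    proof -
      have "norm (drift_rate t r) \<le> M * exp (\<omega> * (t - r)) * norm (f r)"
        unfolding drift_rate_def by (rule U_le) (use that in simp)
      also have "\<dots> \<le> M * exp (\<omega> * (t - r)) * F" using M_pos by (intro mult_left_mono f_le) auto
      finally show ?thesis by (simp add: mult_ac)
    qed
  qed auto
  then show ?thesis by (simp add: absolutely_integrable_on_def)
qed

text \<open>Parameters of the Gaussian \<nu>_t: its covariance Q(t,-infinity) and, next, its mean
  g(t,-infinity).\<close>

definition stat_cov :: "real \<Rightarrow> real^'n^'n" where "stat_cov t = integral {..t} (cov_rate t)"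
definition stat_mean :: "real \<Rightarrow> real^'n" where "stat_mean t = integral {..t} (drift_rate t)"

lemma integral_cov_rate_atMost: "integral {..s} (cov_rate t) = U t s ** stat_cov s ** transpose (U t s)"
proof -
  have "bounded_linear (\<lambda>X. U t s ** X ** transpose (U t s))"
    using bounded_linear_compose[OF bounded_bilinear.bounded_linear_left[OF bounded_bilinear_matrix_mult]
        bounded_bilinear.bounded_linear_right[OF bounded_bilinear_matrix_mult]] .
  from integral_linear[OF cov_rate_integrable this, of s s]
  show ?thesis by (simp add: o_def cov_rate_cocycle[of t _ s, symmetric] stat_cov_def)
qed

lemma stat_cov_split:
  assumes "s \<le> t"
  shows "stat_cov t = U t s ** stat_cov s ** transpose (U t s) + integral {s..t} (cov_rate t)"
  unfolding stat_cov_def[of t] integral_cov_rate_atMost[symmetric]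
  by (intro integral_unique has_integral_atMost_split[OF assms] integrable_integral cov_rate_integrable
      integrable_continuous_interval continuous_on_cov_rate)

lemma stat_mean_split:
  assumes "s \<le> t"
  shows "stat_mean t = U t s *v stat_mean s + integral {s..t} (drift_rate t)"
proof -
  have "((*v) (U t s) \<circ> drift_rate s) integrable_on {..s}"
    by (rule integrable_linear[OF drift_rate_integrable matrix_vector_mul_bounded_linear])
  then have 1: "drift_rate t integrable_on {..s}" by (simp add: o_def drift_rate_cocycle[of t _ s, symmetric])
  have 2: "integral {..s} (drift_rate t) = U t s *v stat_mean s"
    using integral_linear[OF drift_rate_integrable matrix_vector_mul_bounded_linear, of s "U t s"]
    by (simp add: o_def drift_rate_cocycle[of t _ s, symmetric] stat_mean_def)
  show ?thesis
    unfolding stat_mean_def[of t] 2[symmetric]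
    by (intro integral_unique has_integral_atMost_split[OF assms] integrable_integral 1
      integrable_continuous_interval continuous_on_drift_rate)
qed

definition energy :: "real \<Rightarrow> real^'n \<Rightarrow> real \<Rightarrow> real" where
  "energy t x r = (norm (transpose (B r) *v (transpose (U t r) *v x)))\<^sup>2"

lemma energy_eq: "energy t x r = x \<bullet> (cov_rate t r *v x)"
  by (simp only: energy_def cov_rate_quadratic)

lemma energy_integrable: "energy t x integrable_on {..b}"
  using integrable_linear[OF cov_rate_integrable[of t b] bounded_linear_quadratic_form[of x]]
  by (simp add: o_def energy_eq[abs_def])

lemma continuous_on_energy: "continuous_on S (energy t x)"
  unfolding energy_eq[abs_def]
  by (rule bounded_linear.continuous_on[OF bounded_linear_quadratic_form continuous_on_cov_rate])

lemma integral_energy: "integral {..s} (energy t x) = x \<bullet> ((U t s ** stat_cov s ** transpose (U t s)) *v x)"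
  using integral_linear[OF cov_rate_integrable[of t s] bounded_linear_quadratic_form[of x]]
  by (simp add: o_def energy_eq[abs_def] integral_cov_rate_atMost)

lemma energy_lower: "\<mu>\<^sup>2 * (norm (transpose (U t r) *v x))\<^sup>2 \<le> energy t x r"
  unfolding energy_def power_mult_distrib[symmetric]
  using norm_transpose_ge[OF \<mu>_pos B_ge] \<mu>_pos by (intro power_mono) auto

text \<open>Integrates \<open>cov_rate_le\<close>; the decay rate 2 \<omega>, twice that of U, puts
  the factor 2 into the denominator.\<close>

lemma stat_cov_upper: "x \<bullet> (stat_cov t *v x) \<le> M\<^sup>2 * C\<^sup>2 / (- 2 * \<omega>) * (norm x)\<^sup>2"
proof -
  have b: "- 2 * \<omega> > 0" using \<omega>_neg by simp
  let ?K = "M\<^sup>2 * C\<^sup>2 * (norm x)\<^sup>2"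
  have "x \<bullet> (stat_cov t *v x) = integral {..t} (energy t x)" by (simp add: integral_energy)
  also have "\<dots> \<le> integral {..t} (\<lambda>r. ?K * exp (- (- 2 * \<omega>) * (t - r)))"
  proof (rule integral_le[OF energy_integrable exp_decay_integrable(1)[OF b]])
    fix r assume "r \<in> {..t}"
    have "energy t x r \<le> norm x * norm (cov_rate t r *v x)" unfolding energy_eq by (rule norm_cauchy_schwarz)
    also have "\<dots> \<le> norm x * (M\<^sup>2 * C\<^sup>2 * exp (- (- 2 * \<omega>) * (t - r)) * norm x)"
      using \<open>r \<in> {..t}\<close> by (intro mult_left_mono cov_rate_le) auto
    finally show "energy t x r \<le> ?K * exp (- (- 2 * \<omega>) * (t - r))" by (simp add: power2_eq_square mult_ac)
  qed
  also have "\<dots> = M\<^sup>2 * C\<^sup>2 / (- 2 * \<omega>) * (norm x)\<^sup>2" unfolding exp_decay_integrable(2)[OF b] by simp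
  finally show ?thesis .
qed

text \<open>Differential inequality \<open>h' \<ge> -2 c h\<close> for \<open>h r = x \<bullet> U(t,r) Q\<^sub>r U(t,r)\<^sup>T x\<close>: the derivative is the
  energy, bounded below by \<open>B_ge\<close>, while \<open>h\<close> itself is bounded above by the decay of \<open>U\<close>.\<close>
lemma integral_energy_decay:
  assumes "s \<le> t"
  shows "integral {..s} (energy t x) \<le> exp (2 * (\<omega> * \<mu>\<^sup>2 / (M\<^sup>2 * C\<^sup>2)) * (t - s)) * integral {..t} (energy t x)"
proof -
  define c where "c = \<omega> * \<mu>\<^sup>2 / (M\<^sup>2 * C\<^sup>2)"
  define h where "h r = integral {..r} (energy t x)" for r
  have dh: "(h has_real_derivative energy t x r) (at r)" for r
    unfolding h_def[abs_def] by (rule integral_atMost_has_real_derivative[OF continuous_on_energy energy_integrable])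
  have ineq: "0 \<le> energy t x r + 2 * c * h r" for r
  proof -
    \<comment> \<open>The upper bound is used for Q_r at the pulled-back vector, the same one on
      which the energy at r is bounded below; the product of the constants is then exactly
      \<mu>^2.\<close>
    define v where "v = transpose (U t r) *v x"
    have "h r \<le> M\<^sup>2 * C\<^sup>2 / (- 2 * \<omega>) * (norm v)\<^sup>2"
      unfolding h_def integral_energy dot_congruence v_def by (rule stat_cov_upper)
    then have "(- 2 * c) * h r \<le> (- 2 * c) * (M\<^sup>2 * C\<^sup>2 / (- 2 * \<omega>) * (norm v)\<^sup>2)"
      using \<omega>_neg by (intro mult_left_mono) (auto simp: c_def divide_nonpos_nonneg mult_nonpos_nonneg)
    also have "\<dots> = \<mu>\<^sup>2 * (norm v)\<^sup>2"
      using \<omega>_neg M_pos C_pos by (simp add: c_def field_simps)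
    also have "\<dots> \<le> energy t x r" unfolding v_def by (rule energy_lower)
    finally show ?thesis by simp
  qed
  have "h s * exp (2 * c * s) \<le> h t * exp (2 * c * t)"
  proof (rule DERIV_nonneg_imp_nondecreasing[OF assms, where f = "\<lambda>r. h r * exp (2 * c * r)"])
    fix r
    have "((\<lambda>r. h r * exp (2 * c * r)) has_real_derivative (energy t x r + 2 * c * h r) * exp (2 * c * r)) (at r)"
      by (auto intro!: derivative_eq_intros dh simp: algebra_simps)
    moreover have "0 \<le> (energy t x r + 2 * c * h r) * exp (2 * c * r)" using ineq[of r] by simp
    ultimately show "\<exists>y. ((\<lambda>r. h r * exp (2 * c * r)) has_real_derivative y) (at r) \<and> 0 \<le> y" by blast
  qed
  then have "h s * exp (2 * c * s) * exp (- 2 * c * s) \<le> h t * exp (2 * c * t) * exp (- 2 * c * s)"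
    by (rule mult_right_mono) simp
  then show ?thesis
    unfolding h_def[symmetric] c_def[symmetric]
    by (simp add: mult.assoc algebra_simps flip: exp_add)
qed

text \<open>The quadratic form at x is the integral of a nonnegative energy that is positive at r =
  t; the integral increases strictly just before t, so it cannot vanish there.\<close>

lemma stat_cov_pos_def: "pos_def (stat_cov t)"
proof -
  have "transpose (stat_cov t) = integral {..t} (transpose \<circ> cov_rate t)"
    unfolding stat_cov_def by (rule integral_linear[OF cov_rate_integrable bounded_linear_transpose, symmetric])
  then have sym: "transpose (stat_cov t) = stat_cov t" by (simp add: o_def cov_rate_symmetric stat_cov_def)
  have "0 < x \<bullet> (stat_cov t *v x)" if "x \<noteq> 0" for x
  proof -
    have nonneg: "0 \<le> energy t x r" for r by (simp add: energy_def)
    have "0 < energy t x t"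
    proof -
      have "0 < \<mu>\<^sup>2 * (norm (transpose (U t t) *v x))\<^sup>2" using \<mu>_pos that by simp
      then show ?thesis using energy_lower[of t t x] by linarith
    qed
    define h where "h r = integral {..r} (energy t x)" for r
    have h0: "0 \<le> h r" for r
      unfolding h_def by (rule integral_nonneg[OF energy_integrable]) (simp add: nonneg)
    have "(h has_real_derivative energy t x t) (at t)"
      unfolding h_def[abs_def] by (rule integral_atMost_has_real_derivative[OF continuous_on_energy energy_integrable])
    from DERIV_pos_inc_left[OF this \<open>0 < energy t x t\<close>]
    obtain d where d: "d > 0" "\<And>e. 0 < e \<Longrightarrow> e < d \<Longrightarrow> h (t - e) < h t" by blast
    from d(2)[of "d/2"] d(1) h0[of "t - d/2"] have "0 < h t" by simp
    then show ?thesis by (simp add: h_def integral_energy)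
  qed
  with sym show ?thesis by (simp add: pos_def_def)
qed

text \<open>Taking \<rho> strictly above the rate turns the energy estimate into positive
  definiteness of \<rho>^2 Q_t - U Q_s U^T, the gap that the kernel factorisation requires.\<close>

theorem transition_contraction:
  fixes \<phi> :: "real^'n \<Rightarrow> real"
  assumes st: "s < t" and \<rho>: "exp (\<omega> * \<mu>\<^sup>2 / (M\<^sup>2 * C\<^sup>2) * (t - s)) < \<rho>" "\<rho> < 1"
    and \<phi>: "\<phi> \<in> borel_measurable borel"
      "integrable (gaussian_measure (stat_mean t) (stat_cov t)) (\<lambda>x. (\<phi> x)\<^sup>2)"
  defines "P \<equiv> \<lambda>x. \<integral>y. \<phi> y - (\<integral>z. \<phi> z \<partial>gaussian_measure (stat_mean t) (stat_cov t))
      \<partial>gaussian_measure (U t s *v x + integral {s..t} (drift_rate t)) (integral {s..t} (cov_rate t))"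
  shows "integrable (gaussian_measure (stat_mean s) (stat_cov s)) (\<lambda>x. (P x)\<^sup>2)"
    and "(\<integral>x. (P x)\<^sup>2 \<partial>gaussian_measure (stat_mean s) (stat_cov s))
      \<le> \<rho>\<^sup>2 * (\<integral>x. (\<phi> x)\<^sup>2 \<partial>gaussian_measure (stat_mean t) (stat_cov t))"
proof -
  define c where "c = \<omega> * \<mu>\<^sup>2 / (M\<^sup>2 * C\<^sup>2)"
  have \<rho>0: "0 < \<rho>" using \<rho>(1) by (smt (verit) exp_gt_zero)
  let ?S = "U t s ** stat_cov s ** transpose (U t s)"
  have "0 < x \<bullet> ((\<rho>\<^sup>2 *\<^sub>R stat_cov t - ?S) *v x)" if "x \<noteq> 0" for x
  proof -
    have pos: "0 < x \<bullet> (stat_cov t *v x)" using stat_cov_pos_def that by (simp add: pos_def_def)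
    have "x \<bullet> (?S *v x) \<le> exp (2 * c * (t - s)) * (x \<bullet> (stat_cov t *v x))"
      using integral_energy_decay[of s t x] st unfolding integral_energy by (simp add: c_def)
    also have "\<dots> < \<rho>\<^sup>2 * (x \<bullet> (stat_cov t *v x))"
    proof (rule mult_strict_right_mono[OF _ pos])
      have "exp (2 * c * (t - s)) = (exp (c * (t - s)))\<^sup>2" by (simp flip: exp_double add: mult.assoc)
      also have "\<dots> < \<rho>\<^sup>2" using \<rho>(1) by (intro power_strict_mono) (auto simp: c_def)
      finally show "exp (2 * c * (t - s)) < \<rho>\<^sup>2" .
    qed
    finally show ?thesis
      by (simp add: matrix_vector_mult_diff_rdistrib scaleR_matrix_vector_assoc[symmetric] inner_diff_right)
  qed
  moreover have "transpose (\<rho>\<^sup>2 *\<^sub>R stat_cov t - ?S) = \<rho>\<^sup>2 *\<^sub>R stat_cov t - ?S"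
    using stat_cov_pos_def[of t] pos_def_congruence[OF stat_cov_pos_def[of s] det_U[of t s]]
    by (simp add: pos_def_def linear_diff[OF bounded_linear.linear[OF bounded_linear_transpose]] transpose_scalar)
  ultimately have gap: "pos_def (\<rho>\<^sup>2 *\<^sub>R stat_cov t - ?S)" by (simp add: pos_def_def)
  note * = gaussian_kernel_contraction[OF stat_cov_pos_def stat_cov_pos_def stat_cov_split[OF less_imp_le[OF st]]
      det_U \<rho>0 \<rho>(2) gap stat_mean_split[OF less_imp_le[OF st]] \<phi>]
  show "integrable (gaussian_measure (stat_mean s) (stat_cov s)) (\<lambda>x. (P x)\<^sup>2)"
    unfolding P_def by (rule *(1))
  show "(\<integral>x. (P x)\<^sup>2 \<partial>gaussian_measure (stat_mean s) (stat_cov s))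
      \<le> \<rho>\<^sup>2 * (\<integral>x. (\<phi> x)\<^sup>2 \<partial>gaussian_measure (stat_mean t) (stat_cov t))"
    unfolding P_def by (rule *(2))
qed

end

section \<open>Optimisation over the decay rate\<close>

theorem theorem2p17:
  fixes A B :: "real \<Rightarrow> real^'n^'n"
    and f :: "real \<Rightarrow> real^'n"
    and U :: "real \<Rightarrow> real \<Rightarrow> real^'n^'n"
    and M :: "real \<Rightarrow> real"
    and \<mu>0 :: real
    and \<phi> :: "real^'n \<Rightarrow> real"
    and s t :: real
  assumes A_cont: "continuous_on UNIV A" and A_bdd: "bounded (range A)"
    and B_cont: "continuous_on UNIV B" and B_bdd: "bounded (range B)"
    and f_cont: "continuous_on UNIV f" and f_bdd: "bounded (range f)"
    and \<mu>0_pos: "\<mu>0 > 0"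
    and B_below: "\<And>r x. norm (B r *v x) \<ge> \<mu>0 * norm x"
    and U_evol: "evolution_operator A U"
  defines "\<omega>0 \<equiv> Inf {\<omega>. \<exists>K. \<forall>s' t'. s' \<le> t' \<longrightarrow>
                              opnorm (U t' s') \<le> K * exp (\<omega> * (t' - s'))}"
  assumes \<omega>0_neg: "\<omega>0 < 0"
    and M_bound: "\<And>\<omega> s' t'. \<omega> \<in> {\<omega>0<..<0} \<Longrightarrow> s' \<le> t' \<Longrightarrow>
                     opnorm (U t' s') \<le> M \<omega> * exp (\<omega> * (t' - s'))"
  defines "C \<equiv> Sup (range (\<lambda>r. opnorm (B r)))"
  defines "c0 \<equiv> Inf ((\<lambda>\<omega>. \<omega> * \<mu>0\<^sup>2 / ((M \<omega>)\<^sup>2 * C\<^sup>2)) ` {\<omega>0<..<0})"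
  defines "Q \<equiv> (\<lambda>t' s'. integral {s'..t'}
                  (\<lambda>r. U t' r ** B r ** transpose (B r) ** transpose (U t' r)))"
  defines "Qinf \<equiv> (\<lambda>t'. integral {..t'}
                  (\<lambda>r. U t' r ** B r ** transpose (B r) ** transpose (U t' r)))"
  defines "g \<equiv> (\<lambda>t' s'. integral {s'..t'} (\<lambda>r. U t' r *v f r))"
  defines "ginf \<equiv> (\<lambda>t'. integral {..t'} (\<lambda>r. U t' r *v f r))"
  defines "\<nu> \<equiv> (\<lambda>t'. gaussian_measure (ginf t') (Qinf t'))"
  defines "P \<equiv> (\<lambda>s' t' (\<psi> :: real^'n \<Rightarrow> real) x.
                  \<integral>y. \<psi> y \<partial>(gaussian_measure (U t' s' *v x + g t' s') (Q t' s')))"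
  defines "Mt \<equiv> (\<lambda>t' (\<psi> :: real^'n \<Rightarrow> real). \<integral>y. \<psi> y \<partial>(\<nu> t'))"
  assumes st: "s < t"
    and \<phi>_meas: "\<phi> \<in> borel_measurable borel"
    and \<phi>_L2: "integrable (\<nu> t) (\<lambda>y. (\<phi> y)\<^sup>2)"
  shows "integrable (\<nu> s) (\<lambda>x. (P s t (\<lambda>y. \<phi> y - Mt t \<phi>) x)\<^sup>2) \<and>
         sqrt (\<integral>x. (P s t (\<lambda>y. \<phi> y - Mt t \<phi>) x)\<^sup>2 \<partial>(\<nu> s))
           \<le> exp (c0 * (t - s)) * sqrt (\<integral>y. (\<phi> y)\<^sup>2 \<partial>(\<nu> t))"
proof -
  let ?I = "{\<omega>0<..<0}"
  define c where "c \<omega> = \<omega> * \<mu>0\<^sup>2 / ((M \<omega>)\<^sup>2 * C\<^sup>2)" for \<omega>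
  obtain a where a: "\<And>t. opnorm (A t) \<le> a" using bounded_range_opnorm[OF A_bdd] by blast
  obtain b where b: "\<And>t. opnorm (B t) \<le> b" using bounded_range_opnorm[OF B_bdd] by blast
  obtain F where F: "\<And>t. norm (f t) \<le> F" using f_bdd unfolding bounded_iff by auto
  have C_upper: "opnorm (B r) \<le> C" for r
    unfolding C_def by (rule cSup_upper) (auto intro!: bdd_aboveI2 b)
  have C_pos: "C > 0"
  proof -
    \<comment> \<open>Any nonzero vector works: the lower bound on B forces
      \<open>opnorm (B 0)\<close> to be at least \<mu>0.\<close>
    define e :: "real^'n" where "e = axis undefined 1"
    have "\<mu>0 * norm e \<le> opnorm (B 0) * norm e"
      using B_below[of e 0] norm_matrix_vector_le_opnorm[of "B 0" e] by linarith
    then show ?thesis using C_upper[of 0] \<mu>0_pos by (simp add: e_def)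
  qed
  \<comment> \<open>The decay bound is tested at equal times, where U is the identity.\<close>
  have M_ge: "1 \<le> M \<omega>" if "\<omega> \<in> ?I" for \<omega>
  proof -
    have "U 0 0 = mat 1" using U_evol by (simp add: evolution_operator_def)
    then have "opnorm (U 0 0) = 1" by (simp add: opnorm_def onorm_id)
    then show ?thesis using M_bound[OF that, of 0 0] by simp
  qed
  have c_neg: "c \<omega> < 0" if "\<omega> \<in> ?I" for \<omega>
    using that M_ge[OF that] C_pos \<mu>0_pos by (auto simp: c_def intro!: divide_neg_pos mult_neg_pos)
  have contr: "integrable (\<nu> s) (\<lambda>x. (P s t (\<lambda>y. \<phi> y - Mt t \<phi>) x)\<^sup>2) \<and>
      (\<integral>x. (P s t (\<lambda>y. \<phi> y - Mt t \<phi>) x)\<^sup>2 \<partial>(\<nu> s)) \<le> \<rho>\<^sup>2 * (\<integral>y. (\<phi> y)\<^sup>2 \<partial>(\<nu> t))"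
    if \<omega>: "\<omega> \<in> ?I" and \<rho>: "exp (c \<omega> * (t - s)) < \<rho>" "\<rho> < 1" for \<omega> \<rho>
  proof -
    interpret S: stable_linear_system A B f U a "M \<omega>" \<omega> C \<mu>0 F
    proof
      show "norm (A t *v x) \<le> a * norm x" for t x
        using norm_matrix_vector_le_opnorm[of "A t" x] mult_right_mono[OF a[of t], of "norm x"] by simp
      show "norm (B t *v x) \<le> C * norm x" for t x
        using norm_matrix_vector_le_opnorm[of "B t" x] mult_right_mono[OF C_upper[of t], of "norm x"] by simp
      show "norm (U t s *v x) \<le> M \<omega> * exp (\<omega> * (t - s)) * norm x" if "s \<le> t" for s t x
        using norm_matrix_vector_le_opnorm[of "U t s" x] mult_right_mono[OF M_bound[OF \<omega> that], of "norm x"] by simp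
      show "0 < M \<omega>" using M_ge[OF \<omega>] by simp
    qed (use \<omega> B_cont f_cont B_below F \<mu>0_pos C_pos U_evol in auto)
    have eqs: "Qinf = S.stat_cov" "ginf = S.stat_mean"
      "Q = (\<lambda>t s. integral {s..t} (S.cov_rate t))" "g = (\<lambda>t s. integral {s..t} (S.drift_rate t))"
      by (simp_all add: fun_eq_iff Qinf_def ginf_def Q_def g_def S.stat_cov_def S.stat_mean_def
          S.cov_rate_def[abs_def] S.drift_rate_def[abs_def])
    show ?thesis
      using S.transition_contraction[OF st \<rho>[unfolded c_def] \<phi>_meas] \<phi>_L2
      unfolding \<nu>_def P_def Mt_def eqs by blast
  qed
  \<comment> \<open>M(\<omega>) >= 1 and \<omega> > \<omega>0 give the common lower bound \<omega>0
    \<mu>0^2 / C^2; without one, \<open>Inf\<close> on the reals would say nothing about the members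
    of the set.\<close>
  have bdd: "bdd_below (c ` ?I)"
  proof (rule bdd_belowI2)
    fix \<omega> assume \<omega>: "\<omega> \<in> ?I"
    have "- \<omega> * \<mu>0\<^sup>2 / ((M \<omega>)\<^sup>2 * C\<^sup>2) \<le> - \<omega>0 * \<mu>0\<^sup>2 / (1 * C\<^sup>2)"
      using \<omega> M_ge[OF \<omega>] C_pos by (intro frac_le mult_right_mono) (auto simp: one_le_power mult_nonpos_nonneg)
    then show "\<omega>0 * \<mu>0\<^sup>2 / C\<^sup>2 \<le> c \<omega>" by (simp add: c_def)
  qed
  have c0: "c0 = Inf (c ` ?I)" by (simp add: c0_def c_def[abs_def])
  have ne: "?I \<noteq> {}" using \<omega>0_neg by simp
  then obtain \<omega>1 where \<omega>1: "\<omega>1 \<in> ?I" by blast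
  have "c0 \<le> c \<omega>1" unfolding c0 by (rule cInf_lower[OF imageI[OF \<omega>1] bdd])
  then have c0_neg: "c0 < 0" using c_neg[OF \<omega>1] by simp
  then have \<rho>0: "exp (c0 * (t - s)) < 1" using st by (simp add: mult_neg_pos)
  have main: "integrable (\<nu> s) (\<lambda>x. (P s t (\<lambda>y. \<phi> y - Mt t \<phi>) x)\<^sup>2) \<and>
      sqrt (\<integral>x. (P s t (\<lambda>y. \<phi> y - Mt t \<phi>) x)\<^sup>2 \<partial>(\<nu> s)) \<le> \<rho> * sqrt (\<integral>y. (\<phi> y)\<^sup>2 \<partial>(\<nu> t))"
    if \<rho>: "exp (c0 * (t - s)) < \<rho>" "\<rho> < 1" for \<rho>
  proof -
    have \<rho>_pos: "0 < \<rho>" using \<rho>(1) exp_gt_zero[of "c0 * (t - s)"] by linarith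
    \<comment> \<open>The infimum need not be attained; the strict excess of \<rho> leaves room for
      an admissible \<omega> with c(\<omega>) below ln \<rho> / (t - s).\<close>
    have "c0 * (t - s) < ln \<rho>" using \<rho>(1) \<rho>_pos by (metis exp_less_cancel_iff exp_ln)
    then have "c0 < ln \<rho> / (t - s)" using st by (simp add: field_simps)
    then obtain \<omega> where \<omega>: "\<omega> \<in> ?I" "c \<omega> < ln \<rho> / (t - s)"
      using cInf_lessD[of "c ` ?I"] ne unfolding c0 by blast
    then have "c \<omega> * (t - s) < ln \<rho>" using st by (simp add: field_simps)
    then have "exp (c \<omega> * (t - s)) < \<rho>" using \<rho>_pos by (metis exp_less_cancel_iff exp_ln)
    note * = contr[OF \<omega>(1) this \<rho>(2)]
    have "sqrt (\<integral>x. (P s t (\<lambda>y. \<phi> y - Mt t \<phi>) x)\<^sup>2 \<partial>(\<nu> s)) \<le> sqrt (\<rho>\<^sup>2 * (\<integral>y. (\<phi> y)\<^sup>2 \<partial>(\<nu> t)))"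
      using * by simp
    then show ?thesis using * \<rho>_pos by (simp add: real_sqrt_mult)
  qed
  obtain \<rho>1 where "exp (c0 * (t - s)) < \<rho>1" "\<rho>1 < 1" using dense[OF \<rho>0] by blast
  then have int: "integrable (\<nu> s) (\<lambda>x. (P s t (\<lambda>y. \<phi> y - Mt t \<phi>) x)\<^sup>2)" using main by blast
  define l r where "l = sqrt (\<integral>x. (P s t (\<lambda>y. \<phi> y - Mt t \<phi>) x)\<^sup>2 \<partial>(\<nu> s))" and "r = sqrt (\<integral>y. (\<phi> y)\<^sup>2 \<partial>(\<nu> t))"
  have lr: "l \<le> \<rho> * r" if "exp (c0 * (t - s)) < \<rho>" "\<rho> < 1" for \<rho>
    using main[OF that] by (simp add: l_def r_def)
  \<comment> \<open>Here \<rho> decreases to exp(c0 (t - s)). Both norms are independent of \<rho>,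
    so the limit concerns real numbers only; the case r = 0 is separate because of the
    division.\<close>
  have "l \<le> exp (c0 * (t - s)) * r"
  proof (cases "r = 0")
    case True
    then show ?thesis using lr dense[OF \<rho>0] by auto
  next
    case False
    then have r: "r > 0" by (simp add: r_def less_le)
    have "l / r \<le> exp (c0 * (t - s))"
      by (rule dense_ge_bounded[OF \<rho>0]) (use lr r in \<open>simp add: field_simps\<close>)
    then show ?thesis using r by (simp add: field_simps)
  qed
  with int show ?thesis by (simp add: l_def r_def)
qed

end
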